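(* Let $\ell\ge1$ be an integer and let $A_1,\dots,A_\ell,B_1,\dots,B_\ell$ be real numbers such that the sequences $$\lambda_n=(n+B_1)\cdots(n+B_\ell),\qquad \mu_n=(n+A_1)\cdots(n+A_\ell),\qquad n\ge0,$$ satisfy $\lambda_n>0$ for $n\ge0$, $\mu_n>0$ for $n\ge1$ and $\mu_0=0$. Assume that $$1<\sum_{j=1}^{\ell}(B_j-A_j)<\ell-1 .$$ Then the order of the Jacobi matrix corresponding to the birth–death process with rates $\lambda_n,\mu_n$, that is, of the Jacobi matrix with parameters $$q_{n+1}=\lambda_n+\mu_n,\qquad \rho_{n+1}=\sqrt{\lambda_n\mu_{n+1}},\qquad n\ge0,$$ is equal to $1/\ell$.
   Context: A Jacobi matrix with parameters $q_n\in\mathbb R$, $\rho_n>0$ ($n\ge1$) is the semi-infinite tridiagonal symmetric matrix with diagonal $q_1,q_2,\dots$ and off-diagonal entries $\rho_1,\rho_2,\dots$. The orthogonal polynomials of the first and second kind, $P_n(\lambda)$ and $Q_n(\lambda)$, are the solutions of the recurrence $\rho_{n-1}u_{n-1}+q_nu_n+\rho_nu_{n+1}=\lambda u_n$ with initial data $P_0=0$, $P_1=1$ (recurrence for $n\ge1$) and $Q_1=0$, $Q_2=1/\rho_1$ (recurrence for $n\ge2$). The matrix is in the limit-circle case iff $\sum_n(P_n(0)^2+Q_n(0)^2)<\infty$. Order of a limit-circle Jacobi matrix. It is the order of the corresponding canonical system: let $\delta_n=P_n(0)^2+Q_n(0)^2$, $b_0=0$, $b_n=\delta_1+\dots+\delta_n$,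 $L=\lim b_n$, let $e_n\in\mathbb R^2$ be the unit vector in the direction of $(P_n(0),Q_n(0))^T$, and let $\mathsf H(x)=\langle\cdot,e_n\rangle e_n$ for $x\in(b_{n-1},b_n)$. With $J=\begin{pmatrix}0&-1\\1&0\end{pmatrix}$, let $M(x,z)$ be the $2\times2$ matrix solution of $J\frac{dM}{dx}=z\mathsf H(x)M$ on $[0,L]$ with $M(0,z)=I$, and $M(z)=M(L,z)$ (entire in $z$). The order is $\limsup_{|z|\to\infty}\frac{\log\log|M_{ij}(z)|}{\log|z|}$, the order of the entire function $M_{ij}$, which does not depend on $i,j$ and equals the order of $\|M(z)\|$. (Equivalently, it is the common order of the entries of the Nevanlinna matrix of the associated indeterminate moment problem.) *)

theory Defs
  imports "HOL-Analysis.Analysis"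
begin

(* A Jacobi matrix has diagonal q 1, q 2, ... and off-diagonal rho 1, rho 2, ...
   The values q 0 and rho 0 never matter; rho 0 only occurs multiplied by P_0 = 0. *)

fun poly_first :: "(nat \<Rightarrow> real) \<Rightarrow> (nat \<Rightarrow> real) \<Rightarrow> nat \<Rightarrow> real \<Rightarrow> real" where
  "poly_first q \<rho> 0 x = 0"
| "poly_first q \<rho> (Suc 0) x = 1"
| "poly_first q \<rho> (Suc (Suc n)) x =
     ((x - q (Suc n)) * poly_first q \<rho> (Suc n) x - \<rho> n * poly_first q \<rho> n x) / \<rho> (Suc n)"

(* The second-kind sequence starts at index 1; the value at index 0 is a dummy,
   chosen as 0 so that delta below vanishes at index 0. *)

fun poly_second :: "(nat \<Rightarrow> real) \<Rightarrow> (nat \<Rightarrow> real) \<Rightarrow> nat \<Rightarrow> real \<Rightarrow> real" where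
  "poly_second q \<rho> 0 x = 0"
| "poly_second q \<rho> (Suc 0) x = 0"
| "poly_second q \<rho> (Suc (Suc 0)) x = 1 / \<rho> 1"
| "poly_second q \<rho> (Suc (Suc (Suc n))) x =
     ((x - q (Suc (Suc n))) * poly_second q \<rho> (Suc (Suc n)) x
        - \<rho> (Suc n) * poly_second q \<rho> (Suc n) x) / \<rho> (Suc (Suc n))"

definition delta :: "(nat \<Rightarrow> real) \<Rightarrow> (nat \<Rightarrow> real) \<Rightarrow> nat \<Rightarrow> real" where
  "delta q \<rho> n = (poly_first q \<rho> n 0)\<^sup>2 + (poly_second q \<rho> n 0)\<^sup>2"

definition limit_circle :: "(nat \<Rightarrow> real) \<Rightarrow> (nat \<Rightarrow> real) \<Rightarrow> bool" where
  "limit_circle q \<rho> \<longleftrightarrow> summable (delta q \<rho>)"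

definition breakpoint :: "(nat \<Rightarrow> real) \<Rightarrow> (nat \<Rightarrow> real) \<Rightarrow> nat \<Rightarrow> real" where
  "breakpoint q \<rho> n = (\<Sum>k=1..n. delta q \<rho> k)"

definition total_length :: "(nat \<Rightarrow> real) \<Rightarrow> (nat \<Rightarrow> real) \<Rightarrow> real" where
  "total_length q \<rho> = lim (breakpoint q \<rho>)"

definition direction :: "(nat \<Rightarrow> real) \<Rightarrow> (nat \<Rightarrow> real) \<Rightarrow> nat \<Rightarrow> real ^ 2" where
  "direction q \<rho> n = sgn (vector [poly_first q \<rho> n 0, poly_second q \<rho> n 0])"

(* For x strictly between two consecutive breakpoints, the LEAST below is the index of
   the interval containing x. The values at the breakpoints are irrelevant. *)

definition hamiltonian :: "(nat \<Rightarrow> real) \<Rightarrow> (nat \<Rightarrow> real) \<Rightarrow> real \<Rightarrow> complex ^ 2 ^ 2" where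
  "hamiltonian q \<rho> x =
     (let e = direction q \<rho> (LEAST n. x < breakpoint q \<rho> n)
      in \<chi> i j. complex_of_real (e $ i * e $ j))"

definition symplectic_J :: "complex ^ 2 ^ 2" where
  "symplectic_J = vector [vector [0, -1], vector [1, 0]]"

(* The Hamiltonian is a step function, so a solution (in the sense of absolutely continuous
   functions) is a continuous function on [0, L] that satisfies the equation
   classically on each open interval between consecutive breakpoints. *)

definition fundamental_solution ::
  "(nat \<Rightarrow> real) \<Rightarrow> (nat \<Rightarrow> real) \<Rightarrow> complex \<Rightarrow> (real \<Rightarrow> complex ^ 2 ^ 2) \<Rightarrow> bool" where
  "fundamental_solution q \<rho> z M \<longleftrightarrow>
     continuous_on {0..total_length q \<rho>} M \<and> M 0 = mat 1 \<and>
     (\<forall>n\<ge>1. \<forall>x\<in>{breakpoint q \<rho> (n - 1)<..<breakpoint q \<rho> n}.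
        \<exists>D. (M has_vector_derivative D) (at x) \<and>
            symplectic_J ** D = mat z ** hamiltonian q \<rho> x ** M x)"

definition monodromy :: "(nat \<Rightarrow> real) \<Rightarrow> (nat \<Rightarrow> real) \<Rightarrow> complex \<Rightarrow> complex ^ 2 ^ 2" where
  "monodromy q \<rho> z =
     (THE W. \<exists>M. fundamental_solution q \<rho> z M \<and> M (total_length q \<rho>) = W)"

(* log log t is read as -\<infinity> for 0 \<le> t \<le> 1 *)

definition entire_order :: "(complex \<Rightarrow> complex) \<Rightarrow> ereal" where
  "entire_order f =
     Limsup at_infinity (\<lambda>z. if norm (f z) > 1
       then ereal (ln (ln (norm (f z))) / ln (norm z)) else -\<infinity>)"

(* The order is defined in the limit-circle case only, as the common order of the four
   entries of the monodromy matrix. *)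

definition has_jacobi_order :: "(nat \<Rightarrow> real) \<Rightarrow> (nat \<Rightarrow> real) \<Rightarrow> ereal \<Rightarrow> bool" where
  "has_jacobi_order q \<rho> d \<longleftrightarrow>
     limit_circle q \<rho> \<and> (\<forall>i j. entire_order (\<lambda>z. monodromy q \<rho> z $ i $ j) = d)"

end

theory Submission
  imports Defs "HOL-Real_Asymp.Real_Asymp"
begin

text \<open>
  The equation is solved explicitly on each interval, so that the monodromy matrix is the infinite
  product of the factors \<open>I - z J v v\<^sup>T\<close> with \<open>v = (P\<^bsub>n+1\<^esub>(0), Q\<^bsub>n+1\<^esub>(0))\<close>. For a birth-death process,
  \<open>v = \<plusminus>\<surd>\<pi>\<^sub>n (1, - t\<^sub>n)\<close> with \<open>\<pi>\<^sub>n = \<Prod>\<^bsub>k<n\<^esub> \<lambda>\<^sub>k / \<mu>\<^bsub>k+1\<^esub>\<close> and \<open>t\<^sub>n = \<Sum>\<^bsub>k<n\<^esub> \<kappa>\<^sub>k\<close>, \<open>\<kappa>\<^sub>k = 1 / (\<lambda>\<^sub>k \<pi>\<^sub>k)\<close>,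
  and the product becomes the recursion \<open>u' = u + z \<pi>\<^sub>n Y\<close>, \<open>Y' = Y + \<kappa>\<^sub>n u'\<close> of a Krein string with masses
  \<open>\<pi>\<^sub>n \<sim> n\<^bsup>S-l\<^esup>\<close> and lengths \<open>\<kappa>\<^sub>n \<sim> n\<^bsup>-S\<^esup>\<close>, where \<open>S = \<Sum> (B\<^sub>j - A\<^sub>j)\<close>.

  Upper bound: the norm \<open>\<bar>Y\<bar> + \<alpha> \<bar>u\<bar>\<close> with \<open>\<alpha> = \<bar>z\<bar>\<^bsup>-S/l\<^esup>\<close> grows by a factor polynomial in \<open>\<bar>z\<bar>\<close> in each of
  the first \<open>\<bar>z\<bar>\<^bsup>1/l\<^esup>\<close> steps, and by a factor \<open>exp (O(\<bar>z\<bar>\<^bsup>1/l\<^esup>))\<close> in all remaining steps together.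
  Lower bound: for \<open>z > 0\<close> all terms have the same sign, and \<open>\<pi>\<^bsub>n+1\<^esub> \<kappa>\<^sub>n = 1 / \<mu>\<^bsub>n+1\<^esub>\<close> gives
  \<open>u\<^bsub>n+1\<^esub> \<ge> (z / \<mu>\<^sub>n) u\<^sub>n\<close>, that is, growth by at least a factor \<open>e\<close> as long as \<open>\<mu>\<^sub>n \<le> z / e\<close>.
\<close>

section \<open>Canonical systems of Jacobi matrices\<close>

text \<open>The breakpoints accumulate at \<open>L\<close>, so continuity there is the point at
  issue. Gluing the affine pieces as a series of ramps reduces it to uniform convergence. The lemma
  serves to construct a solution of the canonical system.\<close>

lemma piecewise_affine_interpolation:
  fixes W :: "nat \<Rightarrow> 'a::banach" and b :: "nat \<Rightarrow> real"
  assumes b: "strict_mono b" and L: "b \<longlonglongrightarrow> L"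
    and W: "summable (\<lambda>n. norm (W (Suc n) - W n))"
  obtains M where "continuous_on UNIV M"
    and "\<And>n x. x \<in> {b n..b (Suc n)} \<Longrightarrow>
           M x = W n + ((x - b n) / (b (Suc n) - b n)) *\<^sub>R (W (Suc n) - W n)"
    and "W \<longlonglongrightarrow> M L"
proof
  \<comment> \<open>\<open>c n\<close> rises linearly from 0 to 1 across the interval number
    \<open>n\<close> and is constant elsewhere. One formula thus defines \<open>M\<close> on the
    whole line, and at \<open>L\<close> every ramp is complete.\<close>
  define c where "c n x = max 0 (min 1 ((x - b n) / (b (Suc n) - b n)))" for n x
  define M where "M x = W 0 + (\<Sum>n. c n x *\<^sub>R (W (Suc n) - W n))" for x
  have b_less: "b n < b (Suc n)" for n
    using b by (simp add: strict_mono_def)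
  have c_le: "0 \<le> c n x" "c n x \<le> 1" for n x
    by (auto simp: c_def)
  have norm_le: "norm (c n x *\<^sub>R (W (Suc n) - W n)) \<le> norm (W (Suc n) - W n)" for n x
    using c_le[of n x] by (simp add: mult_left_le_one_le)
  have lim: "uniform_limit UNIV (\<lambda>n x. \<Sum>i<n. c i x *\<^sub>R (W (Suc i) - W i))
      (\<lambda>x. \<Sum>n. c n x *\<^sub>R (W (Suc n) - W n)) sequentially"
    by (rule Weierstrass_m_test[OF norm_le W])
  have c_cont: "continuous_on UNIV (c n)" for n
    unfolding c_def using b_less[of n] by (intro continuous_intros) auto
  have "continuous_on UNIV (\<lambda>x. \<Sum>n. c n x *\<^sub>R (W (Suc n) - W n))"
    by (rule uniform_limit_theorem[OF _ lim]) (auto intro!: always_eventually continuous_intros continuous_on_subset[OF c_cont])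
  then show "continuous_on UNIV M"
    unfolding M_def by (intro continuous_intros)
  have tele: "(\<Sum>i<n. W (Suc i) - W i) = W n - W 0" for n
    by (rule sum_lessThan_telescope)
  have mono: "i \<le> j \<Longrightarrow> b i \<le> b j" for i j
    using b by (simp add: strict_mono_less_eq)
  show "M x = W n + ((x - b n) / (b (Suc n) - b n)) *\<^sub>R (W (Suc n) - W n)"
    if x: "x \<in> {b n..b (Suc n)}" for n x
  proof -
    have 1: "c i x = 1" if "i < n" for i
      using mono[of "Suc i" n] that x b_less[of i] by (auto simp: c_def divide_simps)
    have 2: "c i x = 0" if "i > n" for i
      using mono[of "Suc n" i] that x b_less[of i] by (auto simp: c_def divide_simps min_def max_def)
    have 3: "c n x = (x - b n) / (b (Suc n) - b n)"
      using x b_less[of n] by (auto simp: c_def)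
    have "(\<Sum>i. c i x *\<^sub>R (W (Suc i) - W i)) = (\<Sum>i<Suc n. c i x *\<^sub>R (W (Suc i) - W i))"
      by (rule suminf_finite) (auto simp: 2)
    also have "\<dots> = (\<Sum>i<n. W (Suc i) - W i) + c n x *\<^sub>R (W (Suc n) - W n)"
      by (simp add: 1)
    finally show ?thesis
      by (simp add: M_def tele 3)
  qed
  have "b n < L" for n
    using LIMSEQ_le_const[OF L, of "b (Suc n)"] b_less[of n] mono by (meson order_less_le_trans)
  then have "c n L = 1" for n
    using LIMSEQ_le_const[OF L, of "b (Suc n)"] b_less[of n] mono
    by (auto simp: c_def divide_simps not_le)
  then have "M L = W 0 + (\<Sum>n. W (Suc n) - W n)"
    by (simp add: M_def)
  moreover have "(\<lambda>n. \<Sum>i<n. W (Suc i) - W i) \<longlonglongrightarrow> (\<Sum>n. W (Suc n) - W n)"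
    using summable_norm_cancel[OF W] by (rule summable_LIMSEQ)
  then have "(\<lambda>n. W 0 + (W n - W 0)) \<longlonglongrightarrow> W 0 + (\<Sum>n. W (Suc n) - W n)"
    unfolding tele by (intro tendsto_intros)
  ultimately show "W \<longlonglongrightarrow> M L"
    by simp
qed

text \<open>On one interval the coefficient matrix is a multiple of J v v^T, whose square is zero,
  so its exponential is affine. The interval has length |v|^2, which cancels the normalisation of
  \<open>direction\<close>; the factor I - z J v v^T acts from the left.\<close>

primrec transfer :: "(nat \<Rightarrow> real) \<Rightarrow> (nat \<Rightarrow> real) \<Rightarrow> complex \<Rightarrow> nat \<Rightarrow> complex ^ 2 ^ 2" where
  "transfer q \<rho> z 0 = mat 1"
| "transfer q \<rho> z (Suc n) = (\<chi> i j. transfer q \<rho> z n $ i $ j +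
     z * of_real (if i = 1 then poly_second q \<rho> (Suc n) 0 else - poly_first q \<rho> (Suc n) 0) *
     (of_real (poly_first q \<rho> (Suc n) 0) * transfer q \<rho> z n $ 1 $ j +
      of_real (poly_second q \<rho> (Suc n) 0) * transfer q \<rho> z n $ 2 $ j))"

context
  fixes q \<rho> :: "nat \<Rightarrow> real"
  assumes delta_pos: "\<And>n. delta q \<rho> (Suc n) > 0"
    and lc: "limit_circle q \<rho>"
begin

section \<open>Breakpoints and the canonical system on one interval\<close>

lemma breakpoint_Suc: "breakpoint q \<rho> (Suc n) = breakpoint q \<rho> n + delta q \<rho> (Suc n)"
  by (simp add: breakpoint_def)

lemma strict_mono_breakpoint: "strict_mono (breakpoint q \<rho>)"
  by (rule strict_monoI_Suc) (simp add: breakpoint_Suc delta_pos)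

lemma breakpoint_tendsto: "breakpoint q \<rho> \<longlonglongrightarrow> total_length q \<rho>"
proof -
  have "delta q \<rho> 0 = 0"
    by (simp add: delta_def)
  then have "breakpoint q \<rho> = (\<lambda>n. \<Sum>k\<le>n. delta q \<rho> k)"
    by (simp add: fun_eq_iff breakpoint_def sum.atLeast1_atMost_eq sum.atMost_shift)
  then have "breakpoint q \<rho> \<longlonglongrightarrow> suminf (delta q \<rho>)"
    using summable_LIMSEQ'[of "delta q \<rho>"] lc by (simp add: limit_circle_def)
  then show ?thesis
    by (simp add: total_length_def limI)
qed

lemma breakpoint_bounds: "0 \<le> breakpoint q \<rho> n" "breakpoint q \<rho> n \<le> total_length q \<rho>"
proof -
  have "incseq (breakpoint q \<rho>)"
    using strict_mono_breakpoint by (simp add: strict_mono_mono)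
  then show "breakpoint q \<rho> n \<le> total_length q \<rho>"
    using breakpoint_tendsto by (rule incseq_le)
  show "0 \<le> breakpoint q \<rho> n"
    by (auto simp: breakpoint_def delta_def intro!: sum_nonneg)
qed

lemma hamiltonian_eq:
  assumes x: "x \<in> {breakpoint q \<rho> n<..<breakpoint q \<rho> (Suc n)}"
  shows "hamiltonian q \<rho> x $ i $ j =
    of_real ((if i = 1 then poly_first q \<rho> (Suc n) 0 else poly_second q \<rho> (Suc n) 0) *
     (if j = 1 then poly_first q \<rho> (Suc n) 0 else poly_second q \<rho> (Suc n) 0) / delta q \<rho> (Suc n))"
proof -
  have least: "(LEAST k. x < breakpoint q \<rho> k) = Suc n"
  proof (rule Least_equality)
    fix k assume "x < breakpoint q \<rho> k"
    with x have "breakpoint q \<rho> n < breakpoint q \<rho> k"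
      by simp
    then show "Suc n \<le> k"
      using strict_mono_breakpoint by (simp add: strict_mono_less)
  qed (use x in simp)
  define v :: "real ^ 2" where "v = vector [poly_first q \<rho> (Suc n) 0, poly_second q \<rho> (Suc n) 0]"
  have norm_v: "norm v * norm v = delta q \<rho> (Suc n)"
    by (simp add: v_def norm_eq_sqrt_inner inner_vec_def sum_2 delta_def power2_eq_square)
  have sgn_v: "sgn v $ i * sgn v $ j = v $ i * v $ j / delta q \<rho> (Suc n)"
    unfolding norm_v[symmetric] by (simp add: sgn_div_norm divide_inverse mult_ac)
  have v: "v $ i = (if i = 1 then poly_first q \<rho> (Suc n) 0 else poly_second q \<rho> (Suc n) 0)" for i
    using exhaust_2[of i] by (auto simp: v_def)
  show ?thesis
    by (simp add: hamiltonian_def direction_def least Let_def v_def[symmetric] sgn_v v del: of_real_mult)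
qed

text \<open>Inverting \<open>symplectic_J\<close> swaps the two rows up to sign, which produces the
  vector (Q, -P) orthogonal to (P, Q).\<close>

lemma canonical_equation_iff:
  assumes x: "x \<in> {breakpoint q \<rho> n<..<breakpoint q \<rho> (Suc n)}"
  shows "symplectic_J ** D = mat z ** hamiltonian q \<rho> x ** W \<longleftrightarrow>
    (\<forall>i j. D $ i $ j = z / of_real (delta q \<rho> (Suc n)) *
       of_real (if i = 1 then poly_second q \<rho> (Suc n) 0 else - poly_first q \<rho> (Suc n) 0) *
       (of_real (poly_first q \<rho> (Suc n) 0) * W $ 1 $ j + of_real (poly_second q \<rho> (Suc n) 0) * W $ 2 $ j))"
proof -
  define p r d where "p = complex_of_real (poly_first q \<rho> (Suc n) 0)"
    and "r = complex_of_real (poly_second q \<rho> (Suc n) 0)" and "d = complex_of_real (delta q \<rho> (Suc n))"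
  have "d \<noteq> 0"
    using delta_pos[of n] by (simp add: d_def)
  have "- D $ 2 $ j = z * (p * p / d * W $ 1 $ j + p * r / d * W $ 2 $ j) \<longleftrightarrow>
      D $ 2 $ j = z / d * - p * (p * W $ 1 $ j + r * W $ 2 $ j)"
    "D $ 1 $ j = z * (r * p / d * W $ 1 $ j + r * r / d * W $ 2 $ j) \<longleftrightarrow>
      D $ 1 $ j = z / d * r * (p * W $ 1 $ j + r * W $ 2 $ j)" for j
  proof -
    have "z / d * - p * (p * W $ 1 $ j + r * W $ 2 $ j) = - (z * (p * p / d * W $ 1 $ j + p * r / d * W $ 2 $ j))"
      using \<open>d \<noteq> 0\<close> by (simp add: field_simps)
    then show "- D $ 2 $ j = z * (p * p / d * W $ 1 $ j + p * r / d * W $ 2 $ j) \<longleftrightarrow>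
      D $ 2 $ j = z / d * - p * (p * W $ 1 $ j + r * W $ 2 $ j)"
      by (metis minus_minus)
    have "z / d * r * (p * W $ 1 $ j + r * W $ 2 $ j) = z * (r * p / d * W $ 1 $ j + r * r / d * W $ 2 $ j)"
      using \<open>d \<noteq> 0\<close> by (simp add: field_simps)
    then show "D $ 1 $ j = z * (r * p / d * W $ 1 $ j + r * r / d * W $ 2 $ j) \<longleftrightarrow>
      D $ 1 $ j = z / d * r * (p * W $ 1 $ j + r * W $ 2 $ j)"
      by simp
  qed
  then have *: "(\<forall>j. - D $ 2 $ j = z * (p * p / d * W $ 1 $ j + p * r / d * W $ 2 $ j)) \<longleftrightarrow>
      (\<forall>j. D $ 2 $ j = z / d * - p * (p * W $ 1 $ j + r * W $ 2 $ j))"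
    "(\<forall>j. D $ 1 $ j = z * (r * p / d * W $ 1 $ j + r * r / d * W $ 2 $ j)) \<longleftrightarrow>
      (\<forall>j. D $ 1 $ j = z / d * r * (p * W $ 1 $ j + r * W $ 2 $ j))"
    by metis+
  have JD: "(symplectic_J ** D) $ 1 $ j = - D $ 2 $ j" "(symplectic_J ** D) $ 2 $ j = D $ 1 $ j" for j
    by (simp_all add: matrix_matrix_mult_def sum_2 symplectic_J_def)
  have zH: "(mat z ** hamiltonian q \<rho> x ** W) $ 1 $ j = z * (p * p / d * W $ 1 $ j + p * r / d * W $ 2 $ j)"
    "(mat z ** hamiltonian q \<rho> x ** W) $ 2 $ j = z * (r * p / d * W $ 1 $ j + r * r / d * W $ 2 $ j)" for j
    by (simp_all add: matrix_matrix_mult_def sum_2 mat_def hamiltonian_eq[OF x] p_def r_def d_def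
        distrib_left mult.assoc)
  have if_1: "complex_of_real (if (i::2) = 1 then poly_second q \<rho> (Suc n) 0 else - poly_first q \<rho> (Suc n) 0) =
      (if i = 1 then r else - p)" for i
    by (simp add: p_def r_def)
  show ?thesis
    unfolding vec_eq_iff forall_2[of "\<lambda>i. \<forall>j. _ i j"] JD zH * if_1 p_def[symmetric] r_def[symmetric] d_def[symmetric]
    by auto
qed

text \<open>The constant is four entries times 2, the latter from (|p| + |r|)^2 \<le> 2 (p^2 +
  r^2).\<close>

lemma norm_transfer_diff_le:
  "norm (transfer q \<rho> z (Suc n) - transfer q \<rho> z n) \<le>
     8 * norm z * delta q \<rho> (Suc n) * norm (transfer q \<rho> z n)"
proof -
  define p r where "p = poly_first q \<rho> (Suc n) 0" and "r = poly_second q \<rho> (Suc n) 0"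
  let ?W = "transfer q \<rho> z n" and ?D = "transfer q \<rho> z (Suc n) - transfer q \<rho> z n"
  have entry: "norm (?W $ i $ j) \<le> norm ?W" for i j
    by (rule order_trans[OF Finite_Cartesian_Product.norm_nth_le Finite_Cartesian_Product.norm_nth_le])
  have "norm (?D $ i $ j) \<le> 2 * norm z * delta q \<rho> (Suc n) * norm ?W" for i j
  proof -
    have "norm (?D $ i $ j) = norm z * \<bar>if i = 1 then r else - p\<bar> *
        norm (of_real p * ?W $ 1 $ j + of_real r * ?W $ 2 $ j)"
      by (simp add: norm_mult p_def r_def)
    also have "\<dots> \<le> norm z * (\<bar>p\<bar> + \<bar>r\<bar>) * (\<bar>p\<bar> * norm ?W + \<bar>r\<bar> * norm ?W)"
      by (intro mult_mono norm_triangle_le add_mono)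
        (auto simp: norm_mult intro!: mult_left_mono entry)
    also have "\<dots> = norm z * norm ?W * (\<bar>p\<bar> + \<bar>r\<bar>)\<^sup>2"
      by (simp add: power2_eq_square algebra_simps)
    also have "\<dots> \<le> norm z * norm ?W * (2 * delta q \<rho> (Suc n))"
      using sum_squares_bound[of "\<bar>p\<bar>" "\<bar>r\<bar>"]
      by (intro mult_left_mono) (simp_all add: delta_def p_def r_def power2_sum)
    finally show ?thesis
      by (simp add: mult_ac del: transfer.simps)
  qed
  moreover have "norm ?D \<le> (\<Sum>i\<in>UNIV. \<Sum>j\<in>UNIV. norm (?D $ i $ j))"
    unfolding norm_vec_def[where 'a = "complex ^ 2"] norm_vec_def[where 'a = complex]
    by (intro order_trans[OF L2_set_le_sum] sum_mono L2_set_le_sum) auto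
  ultimately have "norm ?D \<le> (\<Sum>i\<in>(UNIV::2 set). \<Sum>j\<in>(UNIV::2 set).
      2 * norm z * delta q \<rho> (Suc n) * norm ?W)"
    by (meson order_trans sum_mono)
  then show ?thesis
    by simp
qed

text \<open>Discrete Gronwall argument: the step estimates multiply up to an exponential of the
  total length, so all matrices are bounded by \<open>E\<close> and the increments are dominated by
  a multiple of \<open>delta\<close>.\<close>

lemma summable_transfer_diff:
  "summable (\<lambda>n. norm (transfer q \<rho> z (Suc n) - transfer q \<rho> z n))"
proof -
  define E where "E = exp (8 * norm z * suminf (delta q \<rho>)) * norm (mat 1 :: complex ^ 2 ^ 2)"
  have summable: "summable (delta q \<rho>)"
    using lc by (simp add: limit_circle_def)
  have nonneg: "0 \<le> delta q \<rho> n" for n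
    by (simp add: delta_def)
  have exp_bound: "norm (transfer q \<rho> z n) \<le>
      exp (8 * norm z * (\<Sum>k<n. delta q \<rho> (Suc k))) * norm (mat 1 :: complex ^ 2 ^ 2)" for n
  proof (induction n)
    case (Suc n)
    have "norm (transfer q \<rho> z (Suc n)) \<le>
        (1 + 8 * norm z * delta q \<rho> (Suc n)) * norm (transfer q \<rho> z n)"
      using norm_triangle_sub[of "transfer q \<rho> z (Suc n)" "transfer q \<rho> z n"] norm_transfer_diff_le[of z n]
      by (simp add: algebra_simps del: transfer.simps)
    also have "\<dots> \<le> exp (8 * norm z * delta q \<rho> (Suc n)) *
        (exp (8 * norm z * (\<Sum>k<n. delta q \<rho> (Suc k))) * norm (mat 1 :: complex ^ 2 ^ 2))"
      by (intro mult_mono exp_ge_add_one_self Suc) (auto simp: nonneg)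
    finally show ?case
      by (simp add: exp_add algebra_simps del: transfer.simps)
  qed auto
  have bound: "norm (transfer q \<rho> z n) \<le> E" for n
  proof -
    have "(\<Sum>k<n. delta q \<rho> (Suc k)) \<le> (\<Sum>k<Suc n. delta q \<rho> k)"
      unfolding sum.lessThan_Suc_shift using nonneg by simp
    also have "\<dots> \<le> suminf (delta q \<rho>)"
      by (rule sum_le_suminf[OF summable]) (auto simp: nonneg)
    finally show ?thesis
      using exp_bound[of n] by (simp add: E_def) (meson exp_le_cancel_iff mult_left_mono mult_right_mono norm_ge_zero order_trans zero_le_numeral mult_nonneg_nonneg)
  qed
  have "summable (\<lambda>n. 8 * norm z * E * delta q \<rho> (Suc n))"
    using summable by (intro summable_mult) (simp add: summable_Suc_iff)
  then show ?thesis
  proof (rule summable_comparison_test')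
    fix n :: nat
    have "norm (transfer q \<rho> z (Suc n) - transfer q \<rho> z n) \<le> 8 * norm z * delta q \<rho> (Suc n) * E"
      by (rule order_trans[OF norm_transfer_diff_le]) (intro mult_left_mono bound mult_nonneg_nonneg, auto simp: nonneg)
    then show "norm (norm (transfer q \<rho> z (Suc n) - transfer q \<rho> z n)) \<le> 8 * norm z * E * delta q \<rho> (Suc n)"
      by (simp add: mult_ac del: transfer.simps)
  qed
qed

text \<open>The row (p, r) annihilates (r, -p), so (p, r) M is constant on each interval. Hence M is
  affine there, with the increment prescribed by \<open>transfer\<close>. This is the uniqueness
  half.\<close>

lemma fundamental_solution_breakpoint:
  assumes M: "fundamental_solution q \<rho> z M"
  shows "M (breakpoint q \<rho> n) = transfer q \<rho> z n"
proof (induction n)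
  case 0
  then show ?case
    using M by (simp add: fundamental_solution_def breakpoint_def)
next
  case (Suc n)
  define p r d where "p = complex_of_real (poly_first q \<rho> (Suc n) 0)"
    and "r = complex_of_real (poly_second q \<rho> (Suc n) 0)" and "d = complex_of_real (delta q \<rho> (Suc n))"
  define s where "s i = (if i = (1::2) then r else - p)" for i
  let ?a = "breakpoint q \<rho> n" and ?b = "breakpoint q \<rho> (Suc n)"
  have "d \<noteq> 0"
    using delta_pos[of n] by (simp add: d_def)
  have ab: "?a < ?b"
    using delta_pos[of n] by (simp add: breakpoint_Suc)
  have "continuous_on {?a..?b} M"
    using M breakpoint_bounds(1)[of n] breakpoint_bounds(2)[of "Suc n"]
    by (auto simp: fundamental_solution_def elim!: continuous_on_subset)
  then have cont: "continuous_on {?a..?b} (\<lambda>x. M x $ i $ j)" for i j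
    by (intro continuous_intros)
  have deriv: "((\<lambda>x. M x $ i $ j) has_vector_derivative
      z / d * s i * (p * M x $ 1 $ j + r * M x $ 2 $ j)) (at x within {?a..?b})"
    if x: "x \<in> {?a..?b} - {?a, ?b}" for x i j
  proof -
    from x have x': "x \<in> {breakpoint q \<rho> n<..<breakpoint q \<rho> (Suc n)}"
      by auto
    then obtain D where D: "(M has_vector_derivative D) (at x)"
      and "symplectic_J ** D = mat z ** hamiltonian q \<rho> x ** M x"
      using M unfolding fundamental_solution_def by (metis One_nat_def diff_Suc_1 le_add1 plus_1_eq_Suc)
    then have "D $ i $ j = z / d * s i * (p * M x $ 1 $ j + r * M x $ 2 $ j)"
      using x' unfolding canonical_equation_iff[OF x'] by (simp add: p_def r_def d_def s_def)
    moreover have "((\<lambda>x. M x $ i $ j) has_vector_derivative D $ i $ j) (at x within {?a..?b})"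
      using D by (intro bounded_linear.has_vector_derivative[OF bounded_linear_vec_nth])
        (rule has_vector_derivative_at_within)
    ultimately show ?thesis
      by simp
  qed
  \<comment> \<open>The equation holds on the open interval only; at the two endpoints continuity
    suffices.\<close>
  have const: "f x = f ?a" if "continuous_on {?a..?b} f" "x \<in> {?a..?b}"
    "\<And>x. x \<in> {?a..?b} - {?a, ?b} \<Longrightarrow> (f has_vector_derivative 0) (at x within {?a..?b})"
    for f :: "real \<Rightarrow> complex" and x
    using that ab
    by (intro has_derivative_zero_unique_strong_convex[where S = "{?a..?b}" and K = "{?a, ?b}"])
      (auto simp: has_vector_derivative_def)
  have e: "p * M x $ 1 $ j + r * M x $ 2 $ j = p * M ?a $ 1 $ j + r * M ?a $ 2 $ j"
    if "x \<in> {?a..?b}" for x j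
  proof (rule const[OF _ that])
    show "continuous_on {?a..?b} (\<lambda>x. p * M x $ 1 $ j + r * M x $ 2 $ j)"
      by (intro continuous_intros cont)
    fix x assume x: "x \<in> {?a..?b} - {?a, ?b}"
    have "((\<lambda>x. p * M x $ 1 $ j + r * M x $ 2 $ j) has_vector_derivative
        p * (z / d * s 1 * (p * M x $ 1 $ j + r * M x $ 2 $ j)) +
        r * (z / d * s 2 * (p * M x $ 1 $ j + r * M x $ 2 $ j))) (at x within {?a..?b})"
      by (intro has_vector_derivative_add has_vector_derivative_mult_right deriv x)
    then show "((\<lambda>x. p * M x $ 1 $ j + r * M x $ 2 $ j) has_vector_derivative 0) (at x within {?a..?b})"
      by (simp add: s_def algebra_simps)
  qed
  \<comment> \<open>By \<open>e\<close> the slope may be frozen at the left end; subtracting the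
    affine function with that slope leaves derivative zero.\<close>
  have "M ?b $ i $ j - (?b - ?a) *\<^sub>R (z / d * s i * (p * M ?a $ 1 $ j + r * M ?a $ 2 $ j)) =
      M ?a $ i $ j - (?a - ?a) *\<^sub>R (z / d * s i * (p * M ?a $ 1 $ j + r * M ?a $ 2 $ j))" for i j
  proof (rule const)
    fix x assume x: "x \<in> {?a..?b} - {?a, ?b}"
    have "((\<lambda>x. M x $ i $ j - (x - ?a) *\<^sub>R (z / d * s i * (p * M ?a $ 1 $ j + r * M ?a $ 2 $ j)))
        has_vector_derivative z / d * s i * (p * M x $ 1 $ j + r * M x $ 2 $ j) -
        z / d * s i * (p * M ?a $ 1 $ j + r * M ?a $ 2 $ j)) (at x within {?a..?b})"
      by (rule derivative_eq_intros deriv x refl)+ auto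
    then show "((\<lambda>x. M x $ i $ j - (x - ?a) *\<^sub>R (z / d * s i * (p * M ?a $ 1 $ j + r * M ?a $ 2 $ j)))
        has_vector_derivative 0) (at x within {?a..?b})"
      using e[of x j] x by simp
  qed (use ab in \<open>auto intro!: continuous_intros cont\<close>)
  moreover have "(?b - ?a) *\<^sub>R (z / d * s i * w) = z * s i * w" for i w
    using \<open>d \<noteq> 0\<close> by (simp add: breakpoint_Suc scaleR_conv_of_real d_def[symmetric])
  ultimately have "M ?b $ i $ j = M ?a $ i $ j + z * s i * (p * M ?a $ 1 $ j + r * M ?a $ 2 $ j)" for i j
    by (simp add: diff_eq_eq)
  then show ?case
    by (simp add: vec_eq_iff Suc p_def r_def s_def if_distrib)
qed

lemma fundamental_solution_exists:
  obtains M where "fundamental_solution q \<rho> z M"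
proof -
  obtain M where cont: "continuous_on UNIV M"
    and M: "\<And>n x. x \<in> {breakpoint q \<rho> n..breakpoint q \<rho> (Suc n)} \<Longrightarrow> M x = transfer q \<rho> z n +
       ((x - breakpoint q \<rho> n) / (breakpoint q \<rho> (Suc n) - breakpoint q \<rho> n)) *\<^sub>R
         (transfer q \<rho> z (Suc n) - transfer q \<rho> z n)"
    using piecewise_affine_interpolation[OF strict_mono_breakpoint breakpoint_tendsto summable_transfer_diff]
    by metis
  have "fundamental_solution q \<rho> z M"
    unfolding fundamental_solution_def
  proof (intro conjI allI impI ballI)
    show "continuous_on {0..total_length q \<rho>} M"
      using cont continuous_on_subset by blast
    show "M 0 = mat 1"
      using M[of 0 0] delta_pos[of 0] by (simp add: breakpoint_def)
    fix k x assume "1 \<le> k" and x: "x \<in> {breakpoint q \<rho> (k - 1)<..<breakpoint q \<rho> k}"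
    then obtain n where n: "k = Suc n"
      by (cases k) auto
    define W V where "W = transfer q \<rho> z n" and "V = transfer q \<rho> z (Suc n)"
    define D where "D = (1 / delta q \<rho> (Suc n)) *\<^sub>R (V - W)"
    have x': "x \<in> {breakpoint q \<rho> n<..<breakpoint q \<rho> (Suc n)}"
      using x by (simp add: n)
    have "((\<lambda>x. W + (x - breakpoint q \<rho> n) *\<^sub>R D) has_vector_derivative D) (at x)"
      by (auto intro!: derivative_eq_intros)
    then have "(M has_vector_derivative D) (at x)"
    proof (rule has_vector_derivative_transform_within_open)
      show "open {breakpoint q \<rho> n<..<breakpoint q \<rho> (Suc n)}"
        by simp
    qed (use x' M[of _ n] in \<open>auto simp: W_def V_def D_def breakpoint_Suc simp del: transfer.simps\<close>)
    moreover have "symplectic_J ** D = mat z ** hamiltonian q \<rho> x ** M x"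
      unfolding canonical_equation_iff[OF x']
    proof (intro allI)
      fix i j :: 2
      define p r d c where "p = complex_of_real (poly_first q \<rho> (Suc n) 0)"
        and "r = complex_of_real (poly_second q \<rho> (Suc n) 0)" and "d = complex_of_real (delta q \<rho> (Suc n))"
        and "c = complex_of_real (x - breakpoint q \<rho> n)"
      have D: "D $ i $ j = z / d * (if i = 1 then r else - p) * (p * W $ 1 $ j + r * W $ 2 $ j)" for i j
        unfolding D_def vector_scaleR_component
        by (simp add: V_def W_def p_def r_def d_def scaleR_conv_of_real)
      have "M x = W + (x - breakpoint q \<rho> n) *\<^sub>R D"
        using x' M[of x n] by (simp add: W_def V_def D_def breakpoint_Suc del: transfer.simps)
      then have "M x $ i $ j = W $ i $ j + c * D $ i $ j" for i j
        unfolding c_def by (simp only: vector_add_component vector_scaleR_component) (simp add: scaleR_conv_of_real)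
      \<comment> \<open>Again (p, r) annihilates the columns of \<open>D\<close>, so the slope
        computed from the left end value \<open>W\<close> is the one that the equation demands at
        \<open>x\<close>.\<close>
      then have "p * M x $ 1 $ j + r * M x $ 2 $ j = p * W $ 1 $ j + r * W $ 2 $ j"
        by (simp add: D algebra_simps)
      then show "D $ i $ j = z / of_real (delta q \<rho> (Suc n)) *
         of_real (if i = 1 then poly_second q \<rho> (Suc n) 0 else - poly_first q \<rho> (Suc n) 0) *
         (of_real (poly_first q \<rho> (Suc n) 0) * M x $ 1 $ j +
          of_real (poly_second q \<rho> (Suc n) 0) * M x $ 2 $ j)"
        using D[of i j] unfolding p_def r_def d_def by simp
    qed
    ultimately show "\<exists>D. (M has_vector_derivative D) (at x) \<and>
        symplectic_J ** D = mat z ** hamiltonian q \<rho> x ** M x"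
      by blast
  qed
  then show ?thesis
    by (rule that)
qed

text \<open>Every solution passes through the transfer matrices at the breakpoints, so by continuity
  its value at the right end is their limit. Together with existence this makes the description in
  \<open>monodromy\<close> well defined.\<close>

theorem transfer_tendsto_monodromy: "transfer q \<rho> z \<longlonglongrightarrow> monodromy q \<rho> z"
proof -
  have lim: "transfer q \<rho> z \<longlonglongrightarrow> M (total_length q \<rho>)" if M: "fundamental_solution q \<rho> z M" for M
  proof -
    have "continuous_on {0..total_length q \<rho>} M"
      using M by (simp add: fundamental_solution_def)
    then have "(\<lambda>n. M (breakpoint q \<rho> n)) \<longlonglongrightarrow> M (total_length q \<rho>)"
      by (rule continuous_on_tendsto_compose[OF _ breakpoint_tendsto])
        (use breakpoint_bounds order_trans[OF breakpoint_bounds] in auto)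
    then show ?thesis
      by (simp add: fundamental_solution_breakpoint[OF M])
  qed
  obtain M where M: "fundamental_solution q \<rho> z M"
    by (rule fundamental_solution_exists)
  have "monodromy q \<rho> z = M (total_length q \<rho>)"
    unfolding monodromy_def using M lim LIMSEQ_unique by (intro the_equality) blast+
  then show ?thesis
    using lim[OF M] by simp
qed

end

text \<open>A limsup dominates the values along any path to infinity, so the positive axis suffices
  for the lower bound. Only \<open>ln g\<close> and \<open>ln h\<close> on the scale of
  \<open>ln x\<close> matter, so the two bounds may differ by subpolynomial factors in the
  exponent.\<close>

lemma entire_order_eqI:
  fixes f :: "complex \<Rightarrow> complex" and g h :: "real \<Rightarrow> real"
  assumes upper: "eventually (\<lambda>z. norm (f z) \<le> exp (g (norm z))) at_infinity"
    and g: "((\<lambda>x. ln (g x) / ln x) \<longlongrightarrow> d) at_top"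
    and lower: "eventually (\<lambda>x. norm (f (of_real x)) \<ge> exp (h x)) at_top"
    and h: "eventually (\<lambda>x. h x > 0) at_top" "((\<lambda>x. ln (h x) / ln x) \<longlongrightarrow> d) at_top"
  shows "entire_order f = ereal d"
proof (rule antisym)
  define F where "F z = (if norm (f z) > 1 then ereal (ln (ln (norm (f z))) / ln (norm z)) else -\<infinity>)" for z
  have norm_at_top: "filterlim (norm :: complex \<Rightarrow> real) at_top at_infinity"
    by (rule filterlim_norm_at_top)
  show "entire_order f \<le> ereal d"
    unfolding entire_order_def F_def[symmetric] Limsup_le_iff
  proof (intro allI impI)
    fix y assume "ereal d < y"
    then obtain e where e: "d < e" "ereal e < y"
      using ereal_dense2 by force
    have "eventually (\<lambda>x. ln (g x) / ln x < e) at_top"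
      using g e(1) by (rule order_tendstoD)
    then have "eventually (\<lambda>z::complex. ln (g (norm z)) / ln (norm z) < e) at_infinity"
      by (rule eventually_compose_filterlim[OF _ norm_at_top])
    moreover have "eventually (\<lambda>z::complex. norm z > 1) at_infinity"
      by (rule eventually_compose_filterlim[OF eventually_gt_at_top norm_at_top])
    ultimately show "eventually (\<lambda>z. y > F z) at_infinity"
      using upper
    proof eventually_elim
      case (elim z)
      show ?case
      proof (cases "norm (f z) > 1")
        case True
        then have pos: "0 < norm (f z)" "0 < ln (norm (f z))"
          by (auto simp del: zero_less_norm_iff)
        then have "ln (norm (f z)) \<le> g (norm z)"
          using elim(3) ln_le_cancel_iff[of "norm (f z)" "exp (g (norm z))"] by (simp del: zero_less_norm_iff)
        then have "ln (ln (norm (f z))) / ln (norm z) \<le> ln (g (norm z)) / ln (norm z)"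
          using elim(2) by (intro divide_right_mono iffD2[OF ln_le_cancel_iff])
            (use pos in linarith, use pos in linarith, assumption, simp)
        also have "\<dots> < e"
          by (rule elim)
        finally have "ereal (ln (ln (norm (f z))) / ln (norm z)) < y"
          using e(2) by (meson ereal_less_eq(3) less_imp_le order_le_less_trans)
        then show ?thesis
          using True by (simp add: F_def)
      next
        case False
        then show ?thesis
          using e(2) by (auto simp: F_def)
      qed
    qed
  qed
  show "ereal d \<le> entire_order f"
  proof (rule ccontr)
    assume "\<not> ereal d \<le> entire_order f"
    then obtain e where e: "Limsup at_infinity F < ereal e" "e < d"
      using ereal_dense2[of "entire_order f" "ereal d"]
      unfolding entire_order_def F_def[symmetric] not_le by auto
    have "eventually (\<lambda>x. F (complex_of_real x) < ereal e) at_top"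
      using Limsup_lessD[OF e(1)] filterlim_of_real_at_infinity
      by (rule eventually_compose_filterlim)
    moreover have "eventually (\<lambda>x. ln (h x) / ln x > e) at_top"
      using h(2) e(2) by (rule order_tendstoD)
    ultimately have "eventually (\<lambda>x::real. False) at_top"
      using h(1) lower eventually_gt_at_top[of 1]
    proof eventually_elim
      case (elim x)
      from elim(3) have "1 < exp (h x)"
        by simp
      with elim(4) have gt_1: "1 < norm (f (of_real x))"
        by linarith
      with elim(4) have "h x \<le> ln (norm (f (of_real x)))"
        by (subst ln_ge_iff) linarith+
      then have "ln (h x) / ln x \<le> ln (ln (norm (f (of_real x)))) / ln x"
        using elim by (intro divide_right_mono) auto
      then show ?case
        using elim gt_1 by (simp add: F_def)
    qed
    then show False
      by simp
  qed
qed

section \<open>Growth of solutions of a string\<close>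

text \<open>Integral comparison in telescoping form, by the mean value theorem. The terms sit at the
  right endpoints of the intervals [i, i + 1], so no boundary term remains.\<close>

lemma sum_powr_tail_le:
  fixes s :: real
  assumes s: "s > 1" and N: "N \<ge> 1"
  shows "(\<Sum>i=N..<n. real (Suc i) powr (- s)) \<le> real N powr (1 - s) / (s - 1)"
proof -
  have step: "real (Suc i) powr (- s) \<le> (real i powr (1 - s) - real (Suc i) powr (1 - s)) / (s - 1)"
    if "i \<ge> 1" for i
  proof -
    have "\<exists>y. real i < y \<and> y < real (Suc i) \<and> real (Suc i) powr (1 - s) - real i powr (1 - s) =
        (real (Suc i) - real i) * ((1 - s) * y powr (- s))"
      using that by (intro MVT2) (auto intro!: derivative_eq_intros)
    then obtain y where y: "real i < y" "y < real (Suc i)"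
      "real (Suc i) powr (1 - s) - real i powr (1 - s) = (1 - s) * y powr (- s)"
      by auto
    have "real (Suc i) powr (- s) \<le> y powr (- s)"
      using y that s by (intro powr_mono2') auto
    moreover have "y powr (- s) = (real i powr (1 - s) - real (Suc i) powr (1 - s)) / (s - 1)"
      using y(3) s by (simp add: field_simps)
    ultimately show ?thesis
      by simp
  qed
  have "(\<Sum>i=N..<n. real (Suc i) powr (- s)) \<le>
      (\<Sum>i=N..<n. (real i powr (1 - s) - real (Suc i) powr (1 - s)) / (s - 1))"
    using N by (intro sum_mono step) auto
  also have "\<dots> = (\<Sum>i=N..<n. real i powr (1 - s) - real (Suc i) powr (1 - s)) / (s - 1)"
    by (simp add: sum_divide_distrib)
  also have "\<dots> \<le> real N powr (1 - s) / (s - 1)"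
  proof (rule divide_right_mono)
    show "(\<Sum>i=N..<n. real i powr (1 - s) - real (Suc i) powr (1 - s)) \<le> real N powr (1 - s)"
      by (cases "N \<le> n") (simp_all add: sum_Suc_diff'[where f = "\<lambda>i. - (real i powr (1 - s))", simplified])
  qed (use s in simp)
  finally show ?thesis .
qed

text \<open>The first summand of the exponent pays for removing the weight \<alpha>, the second
  collects two factors \<open>1 + C * norm z\<close> for each of the first N steps, the third is the
  tail. The tails of masses and lengths converge by \<open>S < l - 1\<close> and
  \<open>1 < S\<close>.\<close>

lemma string_upper:
  fixes m \<kappa> :: "nat \<Rightarrow> real" and Y u :: "nat \<Rightarrow> complex" and C S l :: real
  defines "d \<equiv> 1 / l"
  assumes u_Suc: "\<And>n. u (Suc n) = u n + z * of_real (m n) * Y n"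
    and Y_Suc: "\<And>n. Y (Suc n) = Y n + of_real (\<kappa> n) * u (Suc n)"
    and m_nonneg: "\<And>n. 0 \<le> m n" and \<kappa>_nonneg: "\<And>n. 0 \<le> \<kappa> n"
    and m_le: "\<And>n. m n \<le> C * real (Suc n) powr (S - l)"
    and \<kappa>_le: "\<And>n. \<kappa> n \<le> C * real (Suc n) powr (- S)"
    and S: "1 < S" "S < l - 1" and init: "norm (Y 0) + norm (u 0) \<le> 1"
    and z: "norm z \<ge> 1"
  shows "norm (Y n) + norm (u n) \<le> exp (ln (norm z) + 2 * (norm z powr d + 1) * ln (1 + C * norm z) +
    C * (1 / (l - S - 1) + 1 / (S - 1)) * norm z powr d)"
proof -
  define x \<alpha> N where "x = norm z" and "\<alpha> = x powr (- (S * d))" and "N = nat \<lceil>x powr d\<rceil>"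
  \<comment> \<open>The choice of \<open>\<alpha>\<close> balances the two tail sums over \<open>i \<ge> N\<close> of \<open>e\<close>: both are \<open>O(x powr d)\<close>.\<close>
  define G where "G n = norm (Y n) + \<alpha> * norm (u n)" for n
  define e where "e i = \<alpha> * x * m i + \<kappa> i / \<alpha>" for i
  have x: "x \<ge> 1"
    using z by (simp add: x_def)
  have d: "0 < d" "S * d \<le> 1" "l * d = 1"
    using S by (simp_all add: d_def field_simps)
  have "0 \<le> C"
    using order_trans[OF m_nonneg m_le, of 0] by simp
  have \<alpha>: "0 < \<alpha>" "\<alpha> \<le> 1" "1 / \<alpha> \<le> x"
  proof -
    show "0 < \<alpha>"
      using x by (simp add: \<alpha>_def)
    show "\<alpha> \<le> 1"
      using powr_mono[of "- (S * d)" 0 x] x S d by (simp add: \<alpha>_def)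
    show "1 / \<alpha> \<le> x"
      using powr_mono[of "S * d" 1 x] x d by (simp add: \<alpha>_def powr_minus field_simps)
  qed
  have N: "x powr d \<le> real N" "real N \<le> x powr d + 1" "1 \<le> N"
  proof -
    have "1 \<le> x powr d"
      using x d by (simp add: ge_one_powr_ge_zero)
    then show "x powr d \<le> real N" "real N \<le> x powr d + 1" "1 \<le> N"
      unfolding N_def by linarith+
  qed
  have bounds: "m n \<le> C" "\<kappa> n \<le> C" for n
  proof -
    have "real (Suc n) powr (S - l) \<le> 1" "real (Suc n) powr (- S) \<le> 1"
      using S powr_mono[of "S - l" 0 "real (Suc n)"] powr_mono[of "- S" 0 "real (Suc n)"] by simp_all
    then have "C * real (Suc n) powr (S - l) \<le> C" "C * real (Suc n) powr (- S) \<le> C"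
      using \<open>0 \<le> C\<close> by (metis mult.right_neutral mult_left_mono)+
    then show "m n \<le> C" "\<kappa> n \<le> C"
      using m_le[of n] \<kappa>_le[of n] by linarith+
  qed
  have G_nonneg: "0 \<le> G n" for n
    using \<alpha> by (simp add: G_def)
  \<comment> \<open>Two half-steps: updating \<open>u\<close> costs the first factor, updating
    \<open>Y\<close> with the new \<open>u\<close> the second. Nonnegative cross terms are added to
    complete each product.\<close>
  have G_Suc: "G (Suc n) \<le> ((1 + \<alpha> * x * m n) * (1 + \<kappa> n / \<alpha>)) * G n" for n
  proof -
    have "norm (u (Suc n)) \<le> norm (u n) + x * m n * norm (Y n)"
      using m_nonneg[of n] by (simp add: u_Suc x_def norm_mult norm_triangle_le)
    then have "\<alpha> * norm (u (Suc n)) \<le> \<alpha> * (norm (u n) + x * m n * norm (Y n))"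
      using \<alpha>(1) by (intro mult_left_mono) auto
    moreover have "0 \<le> (\<alpha> * x * m n) * (\<alpha> * norm (u n))"
      using \<alpha> m_nonneg[of n] x by simp
    ultimately have 1: "norm (Y n) + \<alpha> * norm (u (Suc n)) \<le> (1 + \<alpha> * x * m n) * G n"
      by (simp add: G_def algebra_simps)
    have "norm (Y (Suc n)) \<le> norm (Y n) + \<kappa> n * norm (u (Suc n))"
      unfolding Y_Suc using \<kappa>_nonneg[of n] by (intro norm_triangle_le) (simp add: norm_mult)
    also have "\<kappa> n * norm (u (Suc n)) = \<kappa> n / \<alpha> * (\<alpha> * norm (u (Suc n)))"
      using \<alpha>(1) by simp
    finally have "norm (Y (Suc n)) \<le> norm (Y n) + \<kappa> n / \<alpha> * (\<alpha> * norm (u (Suc n)))" .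
    moreover have "0 \<le> \<kappa> n / \<alpha> * norm (Y n)"
      using \<alpha> \<kappa>_nonneg[of n] by simp
    ultimately have "G (Suc n) \<le> (1 + \<kappa> n / \<alpha>) * (norm (Y n) + \<alpha> * norm (u (Suc n)))"
      by (simp add: G_def distrib_left distrib_right)
    also have "\<dots> \<le> (1 + \<kappa> n / \<alpha>) * ((1 + \<alpha> * x * m n) * G n)"
      using \<alpha> \<kappa>_nonneg[of n] by (intro mult_left_mono 1) auto
    finally show ?thesis
      by (simp add: mult_ac)
  qed
  \<comment> \<open>Up to \<open>N\<close> the sum is empty, from \<open>N\<close> on the power is
    frozen; one induction covers both regimes.\<close>
  have G_le: "G n \<le> (1 + C * x) ^ (2 * min n N) * exp (\<Sum>i=N..<n. e i)" for n
  proof (induction n)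
    case 0
    have "\<alpha> * norm (u 0) \<le> norm (u 0)"
      using \<alpha> by (simp add: mult_left_le_one_le)
    then show ?case
      using init by (simp add: G_def)
  next
    case (Suc n)
    show ?case
    proof (cases "n < N")
      case True
      have "\<alpha> * x * m n \<le> 1 * x * C"
        using \<alpha> x m_nonneg[of n] by (intro mult_mono bounds) auto
      moreover have "\<kappa> n * (1 / \<alpha>) \<le> C * x"
        using \<alpha> \<open>0 \<le> C\<close> by (intro mult_mono bounds) auto
      ultimately have "\<alpha> * x * m n \<le> C * x" "\<kappa> n / \<alpha> \<le> C * x"
        by (simp_all add: mult_ac)
      then have "(1 + \<alpha> * x * m n) * (1 + \<kappa> n / \<alpha>) \<le> (1 + C * x) * (1 + C * x)"
        using \<alpha> x m_nonneg[of n] \<kappa>_nonneg[of n] \<open>0 \<le> C\<close> by (intro mult_mono) (auto simp: mult_ac)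
      then have "G (Suc n) \<le> (1 + C * x) * (1 + C * x) * ((1 + C * x) ^ (2 * min n N) * exp (\<Sum>i=N..<n. e i))"
        using x \<open>0 \<le> C\<close> by (intro order_trans[OF G_Suc] mult_mono[OF _ Suc _ G_nonneg]) auto
      then show ?thesis
        using True by (simp add: mult_ac)
    next
      case False
      have "(1 + \<alpha> * x * m n) * (1 + \<kappa> n / \<alpha>) \<le> exp (\<alpha> * x * m n) * exp (\<kappa> n / \<alpha>)"
        using \<alpha> x m_nonneg[of n] \<kappa>_nonneg[of n] by (intro mult_mono exp_ge_add_one_self) auto
      then have "(1 + \<alpha> * x * m n) * (1 + \<kappa> n / \<alpha>) \<le> exp (e n)"
        by (simp add: e_def exp_add)
      then have "G (Suc n) \<le> exp (e n) * ((1 + C * x) ^ (2 * min n N) * exp (\<Sum>i=N..<n. e i))"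
        by (intro order_trans[OF G_Suc] mult_mono Suc G_nonneg) auto
      then show ?thesis
        using False by (simp add: exp_add mult_ac min.absorb2)
    qed
  qed
  \<comment> \<open>The choice of \<open>N\<close> turns \<open>N powr (1 - s)\<close> into a power
    of \<open>x\<close>, and the prefactor with exponent \<open>s * d\<close> leaves exactly
    \<open>x powr d\<close>. It is applied with \<open>s = l - S\<close> and
    \<open>s = S\<close>.\<close>
  have tail: "x powr a * (\<Sum>i=N..<n. real (Suc i) powr (- s)) \<le> x powr d / (s - 1)"
    if "s > 1" "a = s * d" for s a
  proof -
    have "real N powr (1 - s) \<le> (x powr d) powr (1 - s)"
      using N x that by (intro powr_mono2') auto
    then have "(\<Sum>i=N..<n. real (Suc i) powr (- s)) \<le> (x powr d) powr (1 - s) / (s - 1)"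
      using sum_powr_tail_le[OF that(1) N(3), of n] that(1)
      by (meson diff_gt_0_iff_gt divide_right_mono less_imp_le order_trans)
    then have "x powr a * (\<Sum>i=N..<n. real (Suc i) powr (- s)) \<le> x powr a * ((x powr d) powr (1 - s) / (s - 1))"
      by (intro mult_left_mono) auto
    also have "\<dots> = x powr d / (s - 1)"
      by (simp add: powr_powr powr_add[symmetric] that(2) algebra_simps)
    finally show ?thesis .
  qed
  have "(\<Sum>i=N..<n. e i) \<le> (\<Sum>i=N..<n. C * (x powr ((l - S) * d) * real (Suc i) powr (- (l - S)) +
      x powr (S * d) * real (Suc i) powr (- S)))"
  proof (rule sum_mono)
    fix i
    \<comment> \<open>Since \<open>l * d = 1\<close>, the factor \<open>x\<close> is absorbed and
      both prefactors have the form required by \<open>tail\<close>.\<close>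
    have "\<alpha> * x = x powr ((l - S) * d)"
      using x powr_add[of x "- (S * d)" 1] d by (simp add: \<alpha>_def left_diff_distrib)
    moreover have "1 / \<alpha> = x powr (S * d)"
      by (simp add: \<alpha>_def powr_minus field_simps)
    ultimately have "e i = x powr ((l - S) * d) * m i + x powr (S * d) * \<kappa> i"
      using times_divide_eq_left[of 1 \<alpha> "\<kappa> i"] by (simp add: e_def)
    also have "\<dots> \<le> x powr ((l - S) * d) * (C * real (Suc i) powr (S - l)) +
        x powr (S * d) * (C * real (Suc i) powr (- S))"
      by (intro add_mono mult_left_mono m_le \<kappa>_le) auto
    finally show "e i \<le> C * (x powr ((l - S) * d) * real (Suc i) powr (- (l - S)) +
      x powr (S * d) * real (Suc i) powr (- S))"
      by (simp add: algebra_simps)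
  qed
  also have "\<dots> = C * (x powr ((l - S) * d) * (\<Sum>i=N..<n. real (Suc i) powr (- (l - S))) +
      x powr (S * d) * (\<Sum>i=N..<n. real (Suc i) powr (- S)))"
    by (simp only: sum_distrib_left[symmetric] sum.distrib)
  also have "\<dots> \<le> C * (x powr d / (l - S - 1) + x powr d / (S - 1))"
    using S \<open>0 \<le> C\<close> by (intro mult_left_mono add_mono tail) auto
  finally have sum_e: "(\<Sum>i=N..<n. e i) \<le> C * (1 / (l - S - 1) + 1 / (S - 1)) * x powr d"
    by (simp add: algebra_simps)
  have "0 < 1 + C * x"
    using x \<open>0 \<le> C\<close> by (simp add: add_pos_nonneg)
  have "(1 + C * x) ^ (2 * min n N) \<le> (1 + C * x) ^ (2 * N)"
    using x \<open>0 \<le> C\<close> by (intro power_increasing) auto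
  also have "\<dots> = exp (2 * real N * ln (1 + C * x))"
    using \<open>0 < 1 + C * x\<close> by (simp add: powr_realpow[symmetric] powr_def)
  also have "\<dots> \<le> exp (2 * (x powr d + 1) * ln (1 + C * x))"
    using N x \<open>0 \<le> C\<close> by (auto intro!: mult_right_mono)
  finally have pow: "(1 + C * x) ^ (2 * min n N) \<le> exp (2 * (x powr d + 1) * ln (1 + C * x))" .
  have "norm (Y n) \<le> 1 / \<alpha> * norm (Y n)"
    using \<alpha> by (simp add: field_simps mult_left_le_one_le)
  then have "norm (Y n) + norm (u n) \<le> 1 / \<alpha> * G n"
    using \<alpha> by (simp add: G_def field_simps)
  also have "\<dots> \<le> x * (exp (2 * (x powr d + 1) * ln (1 + C * x)) *
      exp (C * (1 / (l - S - 1) + 1 / (S - 1)) * x powr d))"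
    using \<alpha> x G_nonneg sum_e pow
    by (intro mult_mono order_trans[OF G_le]) auto
  also have "\<dots> = exp (ln x + 2 * (x powr d + 1) * ln (1 + C * x) +
    C * (1 / (l - S - 1) + 1 / (S - 1)) * x powr d)"
    using x by (simp add: exp_add)
  finally show ?thesis
    by (simp add: x_def)
qed

text \<open>Dropping nonnegative terms leaves one-step growth by the factor x / \<mu>. The
  comparison starts at \<open>U 1\<close> because \<open>U 0\<close> may vanish.\<close>

lemma string_lower:
  fixes U V m \<kappa> \<mu> :: "nat \<Rightarrow> real" and x C :: real and l :: nat
  assumes U_Suc: "\<And>n. U (Suc n) = U n + x * m n * V n"
    and V_Suc: "\<And>n. V (Suc n) = V n + \<kappa> n * U (Suc n)"
    and nonneg: "\<And>n. 0 \<le> m n" "\<And>n. 0 \<le> \<kappa> n" "0 \<le> U 0" "0 \<le> V 0" and x: "x > 0"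
    and \<mu>: "\<And>n. m (Suc n) * \<kappa> n = 1 / \<mu> (Suc n)" "\<And>n. 0 < \<mu> (Suc n)" "\<And>n. \<mu> (Suc n) \<le> C * real (Suc n) ^ l"
    and "l \<ge> 1"
  shows "incseq U" and "\<exists>k. U 1 * exp ((x / (exp 1 * C)) powr (1 / l) - 1) \<le> U (Suc k)"
proof -
  have UV: "0 \<le> U n \<and> 0 \<le> V n" for n
    by (induction n) (use nonneg x in \<open>auto simp: U_Suc V_Suc\<close>)
  show incseq: "incseq U"
    using UV nonneg x by (intro incseq_SucI) (simp add: U_Suc)
  have "0 < C"
    using \<mu>(2,3)[of 0] by simp
  \<comment> \<open>\<open>w\<close> solves \<open>C * w ^ l = x / exp 1\<close>, so each of the
    first \<open>k\<close> steps gains a factor e; the \<open>- 1\<close> in the exponent pays for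
    rounding down.\<close>
  define w k where "w = (x / (exp 1 * C)) powr (1 / l)" and "k = nat \<lfloor>w\<rfloor>"
  have w: "0 \<le> w" "w ^ l = x / (exp 1 * C)"
    using x \<open>0 < C\<close> \<open>l \<ge> 1\<close> by (simp_all add: w_def powr_realpow[symmetric] powr_powr)
  have k: "real k \<le> w" "w - 1 \<le> real k"
    unfolding k_def using w(1) by linarith+
  have step: "U 1 * exp 1 ^ i \<le> U (Suc i)" if "i \<le> k" for i
    using that
  proof (induction i)
    case (Suc i)
    have "\<mu> (Suc i) \<le> C * w ^ l"
      using Suc.prems k \<open>0 < C\<close>
      by (intro order_trans[OF \<mu>(3)] mult_left_mono power_mono) auto
    also have "\<dots> = x / exp 1"
      using \<open>0 < C\<close> by (simp add: w)
    finally have "exp 1 \<le> x / \<mu> (Suc i)"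
      using \<mu>(2)[of i] by (simp add: field_simps)
    have "U 1 * exp 1 ^ Suc i \<le> exp 1 * U (Suc i)"
      using Suc by (simp add: mult_ac)
    also have "\<dots> \<le> x / \<mu> (Suc i) * U (Suc i)"
      using UV by (intro mult_right_mono \<open>exp 1 \<le> x / \<mu> (Suc i)\<close>) auto
    also have "\<dots> = x * (m (Suc i) * \<kappa> i) * U (Suc i)"
      by (simp add: \<mu>)
    also have "\<dots> = x * m (Suc i) * (\<kappa> i * U (Suc i))"
      by simp
    also have "\<dots> \<le> x * m (Suc i) * V (Suc i)"
      using UV nonneg x by (intro mult_left_mono) (auto simp: V_Suc)
    also have "\<dots> \<le> U (Suc (Suc i))"
      using UV by (simp add: U_Suc[of "Suc i"])
    finally show ?case .
  qed auto
  have "U 1 * exp (w - 1) \<le> U 1 * exp (real k)"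
    using k UV by (intro mult_left_mono) auto
  also have "\<dots> \<le> U (Suc k)"
    using step[of k] by (simp add: exp_of_nat_mult[symmetric])
  finally show "\<exists>k. U 1 * exp ((x / (exp 1 * C)) powr (1 / l) - 1) \<le> U (Suc k)"
    unfolding w_def by blast
qed

section \<open>Birth-death processes\<close>

context
  fixes lam mu q \<rho> :: "nat \<Rightarrow> real"
  assumes lam_pos: "\<And>n. lam n > 0" and mu_pos: "\<And>n. mu (Suc n) > 0" and mu_0: "mu 0 = 0"
    and q_Suc: "\<And>n. q (Suc n) = lam n + mu n"
    and \<rho>_Suc: "\<And>n. \<rho> (Suc n) = sqrt (lam n * mu (Suc n))"
begin

text \<open>The detailed-balance weights:
  \<open>lam n * potential n = mu (Suc n) * potential (Suc n)\<close>.\<close>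

definition potential :: "nat \<Rightarrow> real" where
  "potential n = (\<Prod>k<n. lam k / mu (Suc k))"

definition scale_incr :: "nat \<Rightarrow> real" where
  "scale_incr n = 1 / (lam n * potential n)"

definition scale :: "nat \<Rightarrow> real" where
  "scale n = (\<Sum>k<n. scale_incr k)"

lemma potential_pos: "potential n > 0"
  by (auto simp: potential_def lam_pos mu_pos intro!: prod_pos)

lemma scale_incr_pos: "scale_incr n > 0"
  by (simp add: scale_incr_def lam_pos potential_pos)

lemma potential_Suc: "potential (Suc n) = potential n * (lam n / mu (Suc n))"
  by (simp add: potential_def)

lemma scale_Suc: "scale (Suc n) = scale n + scale_incr n"
  by (simp add: scale_def)

text \<open>Detailed balance in square-root form: conjugation by \<open>sqrt (potential n)\<close>
  turns the Jacobi recurrence into one with the rates as coefficients.\<close>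

lemma \<rho>_sqrt_potential:
  "\<rho> (Suc n) * sqrt (potential (Suc n)) = lam n * sqrt (potential n)"
  "\<rho> (Suc n) * sqrt (potential n) = mu (Suc n) * sqrt (potential (Suc n))"
  using lam_pos[of n] mu_pos[of n] potential_pos[of n]
  by (simp_all add: \<rho>_Suc potential_Suc real_sqrt_mult real_sqrt_divide divide_simps)

lemma \<rho>_pos: "\<rho> (Suc n) > 0"
  by (simp add: \<rho>_Suc lam_pos mu_pos)

text \<open>Substituting (-1)^n \<open>sqrt (potential n)\<close> f_n turns the recurrence at 0 into
  lam_n (f_{n+1} - f_n) = mu_n (f_n - f_{n-1}). The constant f = 1 solves it, at n = 0 because of
  \<open>mu 0 = 0\<close>.\<close>

lemma poly_first_0: "poly_first q \<rho> (Suc n) 0 = (- 1) ^ n * sqrt (potential n)"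
proof (induction n rule: induct_nat_012)
  case 0
  then show ?case
    by (simp add: potential_def)
next
  case 1
  have "\<rho> (Suc 0) * sqrt (potential (Suc 0)) = lam 0"
    using \<rho>_sqrt_potential(1)[of 0] by (simp add: potential_def)
  then show ?case
    using \<rho>_pos[of 0] by (simp add: q_Suc mu_0 field_simps)
next
  case (ge2 n)
  have "\<rho> (Suc (Suc n)) * poly_first q \<rho> (Suc (Suc (Suc n))) 0 =
      - (lam (Suc n) + mu (Suc n)) * ((- 1) ^ Suc n * sqrt (potential (Suc n))) -
      \<rho> (Suc n) * ((- 1) ^ n * sqrt (potential n))"
    using \<rho>_pos[of "Suc n"] ge2 by (simp add: q_Suc)
  also have "\<dots> = (- 1) ^ n * ((lam (Suc n) + mu (Suc n)) * sqrt (potential (Suc n)) - \<rho> (Suc n) * sqrt (potential n))"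
    by (simp add: algebra_simps)
  also have "\<dots> = (- 1) ^ n * (lam (Suc n) * sqrt (potential (Suc n)))"
    unfolding \<rho>_sqrt_potential(2) by (simp add: algebra_simps)
  also have "\<dots> = \<rho> (Suc (Suc n)) * ((- 1) ^ n * sqrt (potential (Suc (Suc n))))"
    unfolding \<rho>_sqrt_potential(1)[symmetric] by simp
  finally show ?case
    using \<rho>_pos[of "Suc n"] by simp
qed

lemma lam_scale_incr: "lam (Suc n) * scale_incr (Suc n) = mu (Suc n) * scale_incr n"
  using lam_pos[of n] lam_pos[of "Suc n"] mu_pos[of n] potential_pos[of n]
  by (simp add: scale_incr_def potential_Suc field_simps)

text \<open>The substitution of \<open>poly_first_0\<close> with the nonconstant solution f = -
  \<open>scale\<close>, whose increments satisfy the equation by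
  \<open>lam_scale_incr\<close>.\<close>

lemma poly_second_0: "poly_second q \<rho> (Suc n) 0 = - ((- 1) ^ n * sqrt (potential n) * scale n)"
proof (induction n rule: induct_nat_012)
  case 0
  then show ?case
    by (simp add: scale_def)
next
  case 1
  have "\<rho> (Suc 0) * sqrt (potential (Suc 0)) = lam 0"
    using \<rho>_sqrt_potential(1)[of 0] by (simp add: potential_def)
  then show ?case
    using \<rho>_pos[of 0] lam_pos[of 0]
    by (simp add: scale_def scale_incr_def potential_def field_simps)
next
  case (ge2 n)
  have "\<rho> (Suc (Suc n)) * poly_second q \<rho> (Suc (Suc (Suc n))) 0 =
      (lam (Suc n) + mu (Suc n)) * ((- 1) ^ Suc n * sqrt (potential (Suc n)) * scale (Suc n)) +
      \<rho> (Suc n) * ((- 1) ^ n * sqrt (potential n) * scale n)"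
    using \<rho>_pos[of "Suc n"] ge2 by (simp add: q_Suc) (simp add: algebra_simps)
  also have "\<dots> = - ((- 1) ^ n * ((lam (Suc n) + mu (Suc n)) * sqrt (potential (Suc n)) * scale (Suc n) -
      \<rho> (Suc n) * sqrt (potential n) * scale n))"
    by (simp add: algebra_simps)
  also have "\<dots> = - ((- 1) ^ n * (lam (Suc n) * scale (Suc n) + mu (Suc n) * scale_incr n) * sqrt (potential (Suc n)))"
    unfolding \<rho>_sqrt_potential(2) by (simp add: scale_Suc algebra_simps)
  also have "\<dots> = - ((- 1) ^ n * scale (Suc (Suc n)) * (lam (Suc n) * sqrt (potential (Suc n))))"
    unfolding lam_scale_incr[symmetric] by (simp add: scale_Suc algebra_simps)
  also have "\<dots> = \<rho> (Suc (Suc n)) * - ((- 1) ^ n * sqrt (potential (Suc (Suc n))) * scale (Suc (Suc n)))"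
    unfolding \<rho>_sqrt_potential(1)[symmetric] by simp
  finally show ?case
    using \<rho>_pos[of "Suc n"] by simp
qed

lemma delta_eq: "delta q \<rho> (Suc n) = potential n * (1 + (scale n)\<^sup>2)"
  using potential_pos[of n]
  by (simp add: delta_def poly_first_0 poly_second_0 power_mult_distrib power_mult[symmetric] algebra_simps
      del: poly_first.simps poly_second.simps)

lemma delta_pos: "delta q \<rho> (Suc n) > 0"
  unfolding delta_eq using potential_pos by (simp add: add_pos_nonneg)

text \<open>
  The variables of the string recursion are \<open>position\<close> and minus the second row of the transfer matrix.
\<close>

definition position :: "complex \<Rightarrow> 2 \<Rightarrow> nat \<Rightarrow> complex" where
  "position z j n = transfer q \<rho> z n $ 1 $ j - of_real (scale n) * transfer q \<rho> z n $ 2 $ j"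

lemma transfer_Suc:
  "transfer q \<rho> z (Suc n) $ 1 $ j = transfer q \<rho> z n $ 1 $ j - z * of_real (scale n * potential n) * position z j n"
  "transfer q \<rho> z (Suc n) $ 2 $ j = transfer q \<rho> z n $ 2 $ j - z * of_real (potential n) * position z j n"
proof -
  \<comment> \<open>The common factor \<sigma> of P and Q enters only through its square
    \<open>potential n\<close>, so the alternating signs disappear.\<close>
  define \<sigma> where "\<sigma> = complex_of_real ((- 1) ^ n * sqrt (potential n))"
  have P: "complex_of_real (poly_first q \<rho> (Suc n) 0) = \<sigma>"
    by (simp only: poly_first_0 \<sigma>_def)
  have Q: "complex_of_real (poly_second q \<rho> (Suc n) 0) = - (\<sigma> * of_real (scale n))"
    by (simp only: poly_second_0 \<sigma>_def of_real_mult of_real_minus)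
  have "((- 1) ^ n * sqrt (potential n)) * ((- 1) ^ n * sqrt (potential n)) = potential n"
    using potential_pos[of n] by (simp add: mult_ac power_mult_distrib[symmetric] flip: power_add)
  then have sq: "complex_of_real (potential n) = \<sigma> * \<sigma>"
    unfolding \<sigma>_def by (metis of_real_mult)
  show "transfer q \<rho> z (Suc n) $ 1 $ j = transfer q \<rho> z n $ 1 $ j - z * of_real (scale n * potential n) * position z j n"
    "transfer q \<rho> z (Suc n) $ 2 $ j = transfer q \<rho> z n $ 2 $ j - z * of_real (potential n) * position z j n"
    by (simp_all add: P Q sq position_def algebra_simps del: poly_first.simps poly_second.simps)
qed

text \<open>The two rows change in the ratio \<open>scale n\<close> to 1, so their combination with
  the old scale is unchanged; only the passage to \<open>scale (Suc n)\<close> contributes.\<close>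

lemma position_Suc: "position z j (Suc n) = position z j n + of_real (scale_incr n) * - transfer q \<rho> z (Suc n) $ 2 $ j"
  unfolding position_def[of _ _ "Suc n"] transfer_Suc
  by (simp add: position_def scale_Suc algebra_simps)

lemma transfer_0: "transfer q \<rho> z 0 $ 1 $ j = (if j = 1 then 1 else 0)"
  "transfer q \<rho> z 0 $ 2 $ j = (if j = 1 then 0 else 1)"
  using exhaust_2[of j] by (auto simp: mat_def)

end

section \<open>Polynomial rates\<close>

lemma le_of_tendsto_divide:
  fixes a b :: "nat \<Rightarrow> real"
  assumes "(\<lambda>n. a n / b n) \<longlonglongrightarrow> c" "\<And>n. b n > 0"
  obtains C where "C > 0" "\<And>n. a n \<le> C * b n"
proof -
  have "Bseq (\<lambda>n. a n / b n)"
    using assms(1) convergentI convergent_imp_Bseq by blast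
  then obtain C where "C > 0" "\<And>n. norm (a n / b n) \<le> C"
    by (auto simp: Bseq_def)
  moreover have "a n \<le> C * b n" for n
    using calculation(2)[of n] assms(2)[of n] by (simp add: divide_le_eq abs_le_iff)
  ultimately show ?thesis
    using that by blast
qed

text \<open>\<open>rGamma_series\<close> is a Pochhammer symbol over a factorial and a power and
  converges to 1/Gamma. The factorials cancel in the quotients, and away from the poles of Gamma no
  limit vanishes.\<close>

lemma pochhammer_ratio_tendsto:
  fixes a b :: "'a \<Rightarrow> real"
  assumes "finite J"
    and a: "\<And>j. j \<in> J \<Longrightarrow> a j \<notin> \<int>\<^sub>\<le>\<^sub>0" and b: "\<And>j. j \<in> J \<Longrightarrow> b j \<notin> \<int>\<^sub>\<le>\<^sub>0"
  obtains c where "c \<noteq> 0"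
    and "(\<lambda>n. (\<Prod>j\<in>J. pochhammer (a j) n / pochhammer (b j) n) / real (Suc n) powr (\<Sum>j\<in>J. a j - b j)) \<longlonglongrightarrow> c"
proof
  define s where "s = (\<Sum>j\<in>J. a j - b j)"
  define c where "c = (\<Prod>j\<in>J. rGamma (a j) / rGamma (b j))"
  show "c \<noteq> 0"
    using a b \<open>finite J\<close> by (auto simp: c_def rGamma_eq_zero_iff)
  have "(\<lambda>n. (\<Prod>j\<in>J. rGamma_series (a j) n / rGamma_series (b j) n)) \<longlonglongrightarrow> c"
    unfolding c_def using b by (intro tendsto_intros rGamma_series_LIMSEQ) (auto simp: rGamma_eq_zero_iff)
  \<comment> \<open>\<open>rGamma_series\<close> at \<open>n\<close> pairs \<open>pochhammer\<close>
    at \<open>Suc n\<close> with a power of \<open>n\<close>; this factor changes the base to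
    \<open>Suc (Suc n)\<close>.\<close>
  moreover have "((\<lambda>n. (real n / real (Suc (Suc n))) powr s) \<longlongrightarrow> 1) sequentially"
    by real_asymp
  ultimately have "(\<lambda>n. (\<Prod>j\<in>J. rGamma_series (a j) n / rGamma_series (b j) n) *
      (real n / real (Suc (Suc n))) powr s) \<longlonglongrightarrow> c * 1"
    by (intro tendsto_mult)
  moreover have "eventually (\<lambda>n. (\<Prod>j\<in>J. rGamma_series (a j) n / rGamma_series (b j) n) *
      (real n / real (Suc (Suc n))) powr s =
      (\<Prod>j\<in>J. pochhammer (a j) (Suc n) / pochhammer (b j) (Suc n)) / real (Suc (Suc n)) powr s) sequentially"
    using eventually_gt_at_top[of 0]
  proof eventually_elim
    case (elim n)
    have "rGamma_series (a j) n / rGamma_series (b j) n =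
        pochhammer (a j) (Suc n) / pochhammer (b j) (Suc n) / real n powr (a j - b j)" for j
      using elim by (simp add: rGamma_series_def powr_def exp_diff left_diff_distrib)
    then have "(\<Prod>j\<in>J. rGamma_series (a j) n / rGamma_series (b j) n) =
        (\<Prod>j\<in>J. pochhammer (a j) (Suc n) / pochhammer (b j) (Suc n)) / real n powr s"
      using elim \<open>finite J\<close> by (simp add: prod_dividef s_def powr_sum del: divide_divide_eq_left)
    then show ?case
      using elim by (simp add: powr_divide)
  qed
  ultimately have "(\<lambda>n. (\<Prod>j\<in>J. pochhammer (a j) (Suc n) / pochhammer (b j) (Suc n)) /
      real (Suc (Suc n)) powr s) \<longlonglongrightarrow> c"
    by (simp add: Lim_transform_eventually)
  then show "(\<lambda>n. (\<Prod>j\<in>J. pochhammer (a j) n / pochhammer (b j) n) / real (Suc n) powr (\<Sum>j\<in>J. a j - b j)) \<longlonglongrightarrow> c"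
    unfolding s_def by (rule LIMSEQ_imp_Suc)
qed

lemma prod_shift_tendsto:
  fixes B :: "nat \<Rightarrow> real"
  shows "(\<lambda>n. (\<Prod>j=1..l. real n + B j) / real (Suc n) ^ l) \<longlonglongrightarrow> 1"
proof -
  have "(\<lambda>n. (\<Prod>j=1..l. (real n + B j) / real (Suc n))) \<longlonglongrightarrow> (\<Prod>j=1..l. 1)"
  proof (rule tendsto_prod)
    show "(\<lambda>n. (real n + B j) / real (Suc n)) \<longlonglongrightarrow> 1" for j
      by real_asymp
  qed
  then show ?thesis
    by (simp add: prod_dividef)
qed

theorem corollary6:
  fixes l :: nat
    and A B :: "nat \<Rightarrow> real"
    and lam mu q \<rho> :: "nat \<Rightarrow> real"
  assumes "l \<ge> 1"
    and "\<And>n. lam n = (\<Prod>j=1..l. real n + B j)"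
    and "\<And>n. mu n = (\<Prod>j=1..l. real n + A j)"
    and "\<And>n. lam n > 0"
    and "\<And>n. n \<ge> 1 \<Longrightarrow> mu n > 0"
    and "mu 0 = 0"
    and "1 < (\<Sum>j=1..l. B j - A j)"
    and "(\<Sum>j=1..l. B j - A j) < real l - 1"
    and "\<And>n. q (Suc n) = lam n + mu n"
    and "\<And>n. \<rho> (Suc n) = sqrt (lam n * mu (Suc n))"
  shows "has_jacobi_order q \<rho> (ereal (1 / real l))"
proof -
  define S d where "S = (\<Sum>j=1..l. B j - A j)" and "d = 1 / real l"
  have S: "1 < S" "S < real l - 1"
    using assms(7,8) by (simp_all add: S_def)
  have d: "0 < d"
    using \<open>l \<ge> 1\<close> by (simp add: d_def)
  have mu_pos: "mu (Suc n) > 0" for n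
    using assms(5) by simp
  note bd = assms(4) mu_pos assms(6,9,10)
  define m \<kappa> t where "m = potential lam mu" and "\<kappa> = scale_incr lam mu" and "t = scale lam mu"
  have m_pos: "m n > 0" and \<kappa>_pos: "\<kappa> n > 0" for n
    using potential_pos[OF bd] scale_incr_pos[OF bd] by (simp_all add: m_def \<kappa>_def)
  \<comment> \<open>Single factors \<open>n + B j\<close> may be negative, but they never vanish, which is all that the Gamma function needs.\<close>
  have B: "B j \<notin> \<int>\<^sub>\<le>\<^sub>0" if "j \<in> {1..l}" for j
  proof
    assume "B j \<in> \<int>\<^sub>\<le>\<^sub>0"
    then obtain n where "B j = - real n"
      by (auto elim: nonpos_Ints_cases')
    then have "lam n = 0"
      using that by (force simp: assms(2))
    then show False
      using assms(4)[of n] by simp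
  qed
  \<comment> \<open>The denominators of \<open>potential n\<close> are \<open>mu 1\<close> to
    \<open>mu n\<close>, hence the parameters \<open>A j + 1\<close>; some \<open>A j\<close> is
    itself 0 because of \<open>mu 0 = 0\<close>.\<close>
  have A: "A j + 1 \<notin> \<int>\<^sub>\<le>\<^sub>0" if "j \<in> {1..l}" for j
  proof
    assume "A j + 1 \<in> \<int>\<^sub>\<le>\<^sub>0"
    then obtain n where "A j + 1 = - real n"
      by (auto elim: nonpos_Ints_cases')
    then have "real (Suc n) + A j = 0"
      by simp
    then have "mu (Suc n) = 0"
      using that unfolding assms(3) by (intro prod_zero) auto
    then show False
      using mu_pos[of n] by simp
  qed

  \<comment> \<open>Power asymptotics of masses and lengths\<close>
  have m_eq: "m n = (\<Prod>j=1..l. pochhammer (B j) n / pochhammer (A j + 1) n)" for n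
  proof -
    have "m n = (\<Prod>k<n. \<Prod>j=1..l. (B j + real k) / (A j + 1 + real k))"
      by (simp add: m_def potential_def[OF bd] assms(2,3) prod_dividef add_ac)
    also have "\<dots> = (\<Prod>j=1..l. \<Prod>k<n. (B j + real k) / (A j + 1 + real k))"
      by (rule prod.swap)
    finally show ?thesis
      by (simp add: pochhammer_prod prod_dividef lessThan_atLeast0)
  qed
  obtain c where c: "c \<noteq> 0" "(\<lambda>n. m n / real (Suc n) powr (S - real l)) \<longlonglongrightarrow> c"
  proof -
    have "(\<Sum>j=1..l. B j - (A j + 1)) = S - real l"
      by (simp add: S_def sum_subtractf sum.distrib)
    then show ?thesis
      using pochhammer_ratio_tendsto[of "{1..l}" B "\<lambda>j. A j + 1"] A B that by (auto simp: m_eq)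
  qed
  \<comment> \<open>\<kappa> is the reciprocal of \<open>lam n * m n\<close>, where
    \<open>lam n\<close> grows like n^l; \<open>c \<noteq> 0\<close> permits the inversion.\<close>
  have "(\<lambda>n. \<kappa> n / real (Suc n) powr - S) \<longlonglongrightarrow> 1 / (1 * c)"
  proof -
    have "(\<lambda>n. 1 / ((lam n / real (Suc n) ^ l) * (m n / real (Suc n) powr (S - real l)))) \<longlonglongrightarrow> 1 / (1 * c)"
      using c prod_shift_tendsto[of B l] unfolding assms(2) by (intro tendsto_intros) auto
    moreover have "1 / ((lam n / real (Suc n) ^ l) * (m n / real (Suc n) powr (S - real l))) =
        \<kappa> n / real (Suc n) powr - S" for n
      by (simp add: \<kappa>_def m_def scale_incr_def[OF bd] powr_diff powr_minus powr_realpow field_simps del: of_nat_Suc)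
    ultimately show ?thesis
      by simp
  qed
  then obtain C2 where C2: "C2 > 0" "\<And>n. \<kappa> n \<le> C2 * real (Suc n) powr - S"
    by (rule le_of_tendsto_divide) auto
  obtain C1 where C1: "C1 > 0" "\<And>n. m n \<le> C1 * real (Suc n) powr (S - real l)"
    using c(2) by (rule le_of_tendsto_divide) auto
  define C where "C = max C1 C2"
  have "C > 0"
    using C1 by (simp add: C_def)
  have m_le: "m n \<le> C * real (Suc n) powr (S - real l)" and \<kappa>_le: "\<kappa> n \<le> C * real (Suc n) powr - S" for n
    by (rule order_trans[OF C1(2)] order_trans[OF C2(2)], simp add: C_def mult_right_mono)+
  obtain C3 where C3: "C3 > 0" "\<And>n. mu (Suc n) \<le> C3 * real (Suc n) ^ l"
  proof -
    have "(\<lambda>n. (\<Prod>j=1..l. real n + (A j + 1)) / real (Suc n) ^ l) \<longlonglongrightarrow> 1"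
      by (rule prod_shift_tendsto)
    moreover have "(\<Prod>j=1..l. real n + (A j + 1)) = mu (Suc n)" for n
      by (simp add: assms(3) add_ac)
    ultimately show ?thesis
      using that by (auto elim: le_of_tendsto_divide)
  qed

  \<comment> \<open>Summability and the limit-circle case\<close>
  have summable_powr: "summable (\<lambda>n. C * real (Suc n) powr s)" if "s < -1" for s
    using that by (intro summable_mult) (simp add: summable_Suc_iff[of "\<lambda>n. real n powr s"] summable_real_powr_iff del: of_nat_Suc)
  have summable_m: "summable m"
    using S m_le m_pos by (intro summable_comparison_test'[OF summable_powr]) (auto simp: less_imp_le abs_of_pos)
  have summable_\<kappa>: "summable \<kappa>"
    using S \<kappa>_le \<kappa>_pos by (intro summable_comparison_test'[OF summable_powr]) (auto simp: less_imp_le abs_of_pos)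
  define T where "T = suminf \<kappa>"
  have t_eq: "t n = (\<Sum>k<n. \<kappa> k)" for n
    by (simp add: t_def \<kappa>_def scale_def[OF bd])
  have t: "0 \<le> t n" "t n \<le> T" for n
    unfolding t_eq T_def using less_imp_le[OF \<kappa>_pos]
    by (auto intro!: sum_nonneg sum_le_suminf[OF summable_\<kappa>])
  have "0 \<le> T"
    using t order_trans by blast
  have "summable (\<lambda>n. delta q \<rho> (Suc n))"
  proof (rule summable_comparison_test')
    show "summable (\<lambda>n. m n * (1 + T\<^sup>2))"
      using summable_m by (rule summable_mult2)
    show "norm (delta q \<rho> (Suc n)) \<le> m n * (1 + T\<^sup>2)" for n
      using m_pos[of n] t[of n]
      by (simp add: delta_eq[OF bd, folded m_def t_def] power_mono)
  qed
  then have lc: "limit_circle q \<rho>"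
    by (simp add: limit_circle_def summable_Suc_iff)
  note lim = transfer_tendsto_monodromy[OF delta_pos[OF bd] lc]
  have "entire_order (\<lambda>z. monodromy q \<rho> z $ i $ j) = ereal d" for i j
  proof -

    \<comment> \<open>Matrix entries in terms of the string variables\<close>
    define u where "u z n = - transfer q \<rho> z n $ 2 $ j" for z n
    define Y where "Y z n = position lam mu q \<rho> z j n" for z n
    have u_Suc: "u z (Suc n) = u z n + z * of_real (m n) * Y z n" for z n
      by (simp add: u_def Y_def transfer_Suc[OF bd] m_def del: transfer.simps)
    have Y_Suc: "Y z (Suc n) = Y z n + of_real (\<kappa> n) * u z (Suc n)" for z n
      by (simp add: u_def Y_def position_Suc[OF bd] \<kappa>_def del: transfer.simps)
    have transfer_1: "transfer q \<rho> z n $ 1 $ j = Y z n - of_real (t n) * u z n" for z n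
      by (simp add: Y_def u_def position_def[OF bd] t_def)
    \<comment> \<open>For the lower bound: in \<open>transfer_1\<close> the two terms may cancel
      when \<open>z\<close> is positive, whereas the increments of the first row are multiples of
      those of \<open>u\<close> with coefficients of one sign.\<close>
    have transfer_1_Suc: "transfer q \<rho> z (Suc n) $ 1 $ j =
        transfer q \<rho> z n $ 1 $ j - of_real (t n) * (u z (Suc n) - u z n)" for z n
      by (simp add: u_Suc transfer_Suc(1)[OF bd] t_def m_def Y_def del: transfer.simps)
    have init: "Y z 0 = (if j = 1 then 1 else 0)" "u z 0 = (if j = 1 then 0 else - 1)" for z
      using exhaust_2[of j] by (auto simp: Y_def u_def position_def[OF bd] mat_def scale_def[OF bd])

    \<comment> \<open>Upper bound for every entry\<close>
    define g where "g x = ln (1 + T) + (ln x + 2 * (x powr d + 1) * ln (1 + C * x) +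
        C * (1 / (l - S - 1) + 1 / (S - 1)) * x powr d)" for x
    have upper: "norm (monodromy q \<rho> z $ i $ j) \<le> exp (g (norm z))" if z: "norm z \<ge> 1" for z
    proof (rule LIMSEQ_le_const2)
      show "(\<lambda>n. norm (transfer q \<rho> z n $ i $ j)) \<longlonglongrightarrow> norm (monodromy q \<rho> z $ i $ j)"
        by (intro tendsto_intros lim)
      have bound: "norm (Y z n) + norm (u z n) \<le> exp (ln (norm z) + 2 * (norm z powr d + 1) * ln (1 + C * norm z) +
          C * (1 / (l - S - 1) + 1 / (S - 1)) * norm z powr d)" for n
        unfolding d_def using S z
        by (intro string_upper[OF u_Suc Y_Suc less_imp_le[OF m_pos] less_imp_le[OF \<kappa>_pos] m_le \<kappa>_le])
          (auto simp: init)
      \<comment> \<open>The first row is \<open>Y - t u\<close> with t \<le> T, the second is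
        \<open>- u\<close>; the factor \<open>1 + T\<close> serves both and enters \<open>g\<close>
        as \<open>ln (1 + T)\<close>.\<close>
      have "norm (transfer q \<rho> z n $ i $ j) \<le> (1 + T) * (norm (Y z n) + norm (u z n))" for n
      proof (cases "i = 1")
        case True
        have "norm (transfer q \<rho> z n $ 1 $ j) \<le> norm (Y z n) + t n * norm (u z n)"
          unfolding transfer_1 using t by (intro order_trans[OF norm_triangle_ineq4]) (simp add: norm_mult)
        also have "\<dots> \<le> (1 + T) * norm (Y z n) + (1 + T) * norm (u z n)"
          using t[of n] \<open>0 \<le> T\<close> by (intro add_mono mult_right_mono) (auto simp: distrib_right)
        finally show ?thesis
          using True by (simp add: algebra_simps)
      next
        case False
        then have "i = 2"
          using exhaust_2[of i] by auto
        then have "norm (transfer q \<rho> z n $ i $ j) \<le> 1 * (norm (Y z n) + norm (u z n))"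
          by (simp add: u_def)
        also have "\<dots> \<le> (1 + T) * (norm (Y z n) + norm (u z n))"
          using \<open>0 \<le> T\<close> by (intro mult_right_mono) auto
        finally show ?thesis .
      qed
      also have "(1 + T) * (norm (Y z n) + norm (u z n)) \<le> exp (g (norm z))" for n
        using \<open>0 \<le> T\<close> mult_left_mono[OF bound[of n], of "1 + T"] by (simp add: g_def exp_add)
      finally show "\<exists>N. \<forall>n\<ge>N. norm (transfer q \<rho> z n $ i $ j) \<le> exp (g (norm z))"
        by blast
    qed

    \<comment> \<open>Lower bound on the positive axis\<close>
    define K where "K = exp 1 * C3"
    have "K > 0"
      using C3 by (simp add: K_def)
    \<comment> \<open>One constant for both rows: the second needs \<open>b \<le> 1\<close>, the
      first \<open>b \<le> t n\<close> for \<open>n \<ge> 1\<close>. The index starts at 1 because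
      \<open>t 0 = 0\<close>.\<close>
    define b where "b = min 1 (t 1)"
    have b: "0 < b" "b \<le> 1" "b \<le> t 1"
      using \<kappa>_pos[of 0] by (auto simp: b_def t_eq)
    \<comment> \<open>The subtracted \<open>x\<close> bounds \<open>U 1\<close>, and the
      \<open>- 1\<close> bounds the starting value of the first row.\<close>
    have lower: "b * (exp ((x / K) powr d - 1) - x) - 1 \<le> norm (monodromy q \<rho> (of_real x) $ i $ j)"
      if x: "x \<ge> 1" for x
    proof -
      \<comment> \<open>In the second column \<open>u\<close> starts at -1; the sign makes both
        initial values nonnegative. Real parts obey the same recursion, since \<open>x\<close> and
        the coefficients are real.\<close>
      define \<sigma> :: real where "\<sigma> = (if j = 1 then 1 else - 1)"
      define U V where "U n = \<sigma> * Re (u (of_real x) n)" and "V n = \<sigma> * Re (Y (of_real x) n)" for n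
      have U_Suc: "U (Suc n) = U n + x * m n * V n" for n
        by (simp add: U_def V_def u_Suc algebra_simps flip: of_real_mult)
      have V_Suc: "V (Suc n) = V n + \<kappa> n * U (Suc n)" for n
        by (simp add: U_def V_def Y_Suc algebra_simps)
      \<comment> \<open>\<open>m 0 = 1\<close> as an empty product, so \<open>U 1\<close> is
        \<open>x\<close> in the first column and 1 in the second.\<close>
      have U_1: "U 1 = U 0 + x * V 0"
        using U_Suc[of 0] by (simp add: m_def potential_def[OF bd])
      have UV_0: "0 \<le> U 0" "0 \<le> V 0" "1 \<le> U 1" "U 1 \<le> x"
        unfolding U_1 using x by (auto simp: U_def V_def \<sigma>_def init)
      have recip: "m (Suc n) * \<kappa> n = 1 / mu (Suc n)" for n
        using assms(4)[of n] m_pos[of n]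
        by (simp add: m_def \<kappa>_def potential_Suc[OF bd] scale_incr_def[OF bd])
      note string = string_lower[OF U_Suc V_Suc less_imp_le[OF m_pos] less_imp_le[OF \<kappa>_pos] UV_0(1,2) _ recip mu_pos C3(2) \<open>l \<ge> 1\<close>]
      have incseq: "incseq U"
        by (rule string(1)) (use x in auto)
      obtain k where k_1: "U 1 * exp ((x / K) powr d - 1) \<le> U (Suc k)"
        using string(2) x unfolding K_def d_def by fastforce
      have "1 * exp ((x / K) powr d - 1) \<le> U 1 * exp ((x / K) powr d - 1)"
        by (intro mult_right_mono UV_0) auto
      with k_1 have k: "exp ((x / K) powr d - 1) \<le> U (Suc k)"
        by linarith
      have large: "b * (exp ((x / K) powr d - 1) - x) - 1 \<le> b * (U n - U 1) - 1" if "n \<ge> Suc k" for n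
        using k UV_0 incseqD[OF incseq that] b by (intro diff_right_mono mult_left_mono) auto
      show ?thesis
      proof (rule LIMSEQ_le_const)
        show "(\<lambda>n. norm (transfer q \<rho> (of_real x) n $ i $ j)) \<longlonglongrightarrow> norm (monodromy q \<rho> (of_real x) $ i $ j)"
          by (intro tendsto_intros lim)
        have *: "b * (U n - U 1) - 1 \<le> norm (transfer q \<rho> (of_real x) n $ i $ j)" if "n \<ge> 1" for n
        proof (cases "i = 1")
          case True
          \<comment> \<open>With this sign \<open>W\<close> has the nonnegative increments
            \<open>t n * (U (Suc n) - U n)\<close>, so from index 1 on it grows at least
            \<open>b\<close> times as fast as \<open>U\<close>.\<close>
          define W where "W n = - \<sigma> * Re (transfer q \<rho> (of_real x) n $ 1 $ j)" for n
          have W_Suc: "W (Suc n) = W n + t n * (U (Suc n) - U n)" for n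
            by (simp add: W_def transfer_1_Suc U_def algebra_simps del: transfer.simps)
          have "b * (U n - U 1) - 1 \<le> W n"
            using that
          proof (induction n rule: dec_induct)
            case base
            have "W 1 = W 0"
              using W_Suc[of 0] by (simp add: t_eq)
            also have "W 0 \<ge> - 1"
              by (simp add: W_def transfer_0[OF bd] \<sigma>_def del: transfer.simps)
            finally show ?case
              by simp
          next
            case (step n)
            have "t 1 \<le> t n"
              unfolding t_eq using step.hyps less_imp_le[OF \<kappa>_pos] by (intro sum_mono2) auto
            with b(3) have "b \<le> t n"
              by linarith
            then have "b * (U (Suc n) - U n) \<le> t n * (U (Suc n) - U n)"
              using incseq_SucD[OF incseq, of n] by (intro mult_right_mono) auto
            then show ?case
              using step.IH by (simp add: W_Suc algebra_simps)
          qed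
          also have "W n \<le> \<bar>W n\<bar>"
            by (rule abs_ge_self)
          also have "\<dots> = \<bar>Re (transfer q \<rho> (of_real x) n $ 1 $ j)\<bar>"
            by (simp add: W_def \<sigma>_def)
          also have "\<dots> \<le> norm (transfer q \<rho> (of_real x) n $ 1 $ j)"
            by (rule abs_Re_le_cmod)
          finally show ?thesis
            using True by simp
        next
          case False
          then have "i = 2"
            using exhaust_2[of i] by auto
          have "b * (U n - U 1) \<le> 1 * (U n - U 1)"
            using b incseqD[OF incseq that] by (intro mult_right_mono) auto
          then have "b * (U n - U 1) - 1 \<le> U n"
            using UV_0 by simp
          also have "U n \<le> \<bar>U n\<bar>"
            by (rule abs_ge_self)
          also have "\<dots> = \<bar>Re (transfer q \<rho> (of_real x) n $ 2 $ j)\<bar>"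
            by (simp add: U_def u_def \<sigma>_def)
          also have "\<dots> \<le> norm (transfer q \<rho> (of_real x) n $ 2 $ j)"
            by (rule abs_Re_le_cmod)
          finally show ?thesis
            using \<open>i = 2\<close> by simp
        qed
        show "\<exists>N. \<forall>n\<ge>N. b * (exp ((x / K) powr d - 1) - x) - 1 \<le> norm (transfer q \<rho> (of_real x) n $ i $ j)"
          by (intro exI[of _ "Suc k"] allI impI order_trans[OF large *]) auto
      qed
    qed
    show ?thesis
    proof (rule entire_order_eqI)
      have "eventually (\<lambda>z::complex. norm z \<ge> 1) at_infinity"
        by (rule eventually_compose_filterlim[OF eventually_ge_at_top filterlim_norm_at_top])
      then show "eventually (\<lambda>z. norm (monodromy q \<rho> z $ i $ j) \<le> exp (g (norm z))) at_infinity"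
        by eventually_elim (rule upper)
      \<comment> \<open>The dominant term of \<open>g\<close> is
        \<open>2 * x powr d * ln (1 + C * x)\<close>; its logarithmic factor disappears in the
        quotient by \<open>ln x\<close>.\<close>
      have "0 < real l - S - 1" "0 < S - 1" "0 < 1 + T"
        using S \<open>0 \<le> T\<close> by auto
      then show "((\<lambda>x. ln (g x) / ln x) \<longlongrightarrow> d) at_top"
        unfolding g_def using d \<open>0 < C\<close> by real_asymp
      \<comment> \<open>Half of the exponent is given up to absorb \<open>b\<close>, the linear term
        and the constants.\<close>
      have "eventually (\<lambda>x. exp ((x / K) powr d / 2) \<le> b * (exp ((x / K) powr d - 1) - x) - 1) at_top"
        using d b(1) \<open>0 < K\<close> by real_asymp
      then show "eventually (\<lambda>x. exp ((x / K) powr d / 2) \<le> norm (monodromy q \<rho> (of_real x) $ i $ j)) at_top"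
        using eventually_ge_at_top[of 1] by eventually_elim (use lower order_trans in blast)
      show "eventually (\<lambda>x. 0 < (x / K) powr d / 2) at_top"
        using d \<open>0 < K\<close> by real_asymp
      show "((\<lambda>x. ln ((x / K) powr d / 2) / ln x) \<longlongrightarrow> d) at_top"
        using d \<open>0 < K\<close> by real_asymp
    qed
  qed
  then show ?thesis
    using lc by (simp add: has_jacobi_order_def d_def)
qed

end
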